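(* Let $A$ be a set and $F:\mathrm{Set}\to\mathrm{Set}$ the functor $FX=A\times X$. (i) For every endofunctor $G$ on $\mathrm{Set}$, the functor $\mathbb F(G)=(A\times G(-))^{A^{(-)}}$, together with the natural transformation $\epsilon:\mathbb F(G)F\Rightarrow FG$ given by $\epsilon_X(\varphi)=(\mathrm{id}\times G\pi_2)(\varphi(\pi_1))$ for $\varphi:A^{A\times X}\to A\times G(A\times X)$, is the right Kan extension of $FG$ along $F$; i.e., $\mathbb F$ is the familiar of $F$: for every endofunctor $H$ and every natural transformation $\theta:HF\Rightarrow FG$, the natural transformation $\hat\theta:H\Rightarrow\mathbb F(G)$ defined below is the unique one with $\epsilon\circ\hat\theta F=\theta$. (ii) The assignment $(\Sigma,\lambda)\mapsto(\Sigma,\hat\lambda)$ (with $H=G=\Sigma$), identity on morphisms, is a functor witnessing an isomorphism of categories $\mathrm{DL}(F)\cong\mathrm{Coalg}(\mathbb F)$.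
   Context: $\mathbb F(G)$ acts on a map $h:X\to Y$ by $\mathbb F(G)(h)(\varphi)(\varsigma)=(\mathrm{id}_A\times Gh)(\varphi(\varsigma\circ h))$ for $\varphi:A^X\to A\times GX$, $\varsigma:Y\to A$; on a natural transformation $\alpha:G\Rightarrow G'$, $\mathbb F(\alpha)_X=(\mathrm{id}_A\times\alpha_X)^{A^X}$. The costrength of a functor $H$ is $\mathrm{cs}^H_{B,Y}:H(Y^B)\to(HY)^B$, $\mathrm{cs}^H_{B,Y}(t)(b)=H(\epsilon^b)(t)$ where $\epsilon^b(g)=g(b)$. Let $c_X:X\to(A\times X)^{A^X}$, $c_X(x)(\varsigma)=(\varsigma(x),x)$. For $\theta:HF\Rightarrow FG$, $\hat\theta_X=(\theta_X)^{A^X}\circ\mathrm{cs}^H_{A^X,A\times X}\circ Hc_X:HX\to(A\times GX)^{A^X}$. $\mathrm{DL}(F)$ is the category whose objects are pairs $(\Sigma,\lambda)$ of an endofunctor $\Sigma$ on Set and a natural transformation $\lambda:\Sigma F\Rightarrow F\Sigma$, and whose morphisms $(\Sigma_1,\lambda_1)\to(\Sigma_2,\lambda_2)$ are natural transformations $\theta:\Sigma_1\Rightarrow\Sigma_2$ with $\lambda_2\circ\theta F=F\theta\circ\lambda_1$. $\mathrm{Coalg}(\mathbb F)$ has objects $(\Sigma,\delta:\Sigma\Rightarrow\mathbb F(\Sigma))$ and morphisms $\theta:\Sigma_1\Rightarrow\Sigma_2$ with $\mathbb F(\theta)\circ\delta_1=\delta_2\circ\theta$. The familiar of $F$ is defined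 as the functor $G\mapsto\mathrm{Ran}_F(FG)$ on the functor category $[\mathrm{Set},\mathrm{Set}]$. *)

theory Defs
  imports "HOL-Library.FuncSet" "HOL-Library.Nat_Bijection"
begin

section \<open>Universes of sets\<close>

text \<open>
  HOL has no type of all sets, so the category of sets is built over a type \<open>'u\<close> whose elements
  \<^emph>\<open>are\<close> sets: \<open>elts x\<close> is the collection of members of \<open>x\<close>. The axioms are extensionality,
  separation, union, power set and replacement, where separation and replacement range over
  arbitrary HOL predicates and functions. Every Grothendieck universe is an instance, and so is
  the ZFC universe in extensions of HOL that provide it. Infinity and foundation are not needed
  and not assumed, so that the axioms also have a model in plain HOL, the hereditarily finite sets
  (lemma \<open>hereditarily_finite\<close>).
\<close>

class set_universe =
  fixes elts :: "'a \<Rightarrow> 'a set"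
  assumes elts_inj: "inj elts"
    and elts_separation: "S \<subseteq> elts x \<Longrightarrow> S \<in> range elts"
    and elts_union: "(\<Union>y\<in>elts x. elts y) \<in> range elts"
    and elts_power: "{y. elts y \<subseteq> elts x} \<in> range elts"
    and elts_replacement: "f ` elts x \<in> range elts"

lemma hereditarily_finite: "class.set_universe set_decode"
proof -
  have rng: "range set_decode = {S. finite S}"
  proof (intro equalityI subsetI)
    fix S :: "nat set" assume "S \<in> {S. finite S}"
    then have "S = set_decode (set_encode S)" by simp
    then show "S \<in> range set_decode" by (rule range_eqI)
  qed auto
  have "y \<in> set_encode ` Pow (set_decode x)" if "set_decode y \<subseteq> set_decode x" for x y
    using that by (intro image_eqI[of _ _ "set_decode y"]) simp_all
  then have "{y. set_decode y \<subseteq> set_decode x} \<subseteq> set_encode ` Pow (set_decode x)" for x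
    by blast
  then have pow: "finite {y. set_decode y \<subseteq> set_decode x}" for x
    by (rule finite_subset) simp
  have "inj set_decode"
    by (rule inj_on_inverseI[where g = set_encode]) simp
  then show ?thesis
    unfolding class.set_universe_def rng using pow by (simp add: finite_subset[OF _ finite_set_decode])
qed

context set_universe
begin

text \<open>\<open>vset S\<close> is the set with members \<open>S\<close>; it is meaningful only if there is such a set.\<close>

definition vset :: "'a set \<Rightarrow> 'a" where
  "vset S = inv elts S"

text \<open>Kuratowski pairs, and functions as sets of pairs.\<close>

definition vpair :: "'a \<Rightarrow> 'a \<Rightarrow> 'a" where
  "vpair x y = vset {vset {x}, vset {x, y}}"

definition vfst :: "'a \<Rightarrow> 'a" where
  "vfst p = (THE x. \<exists>y. p = vpair x y)"

definition vsnd :: "'a \<Rightarrow> 'a" where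
  "vsnd p = (THE y. \<exists>x. p = vpair x y)"

definition vtimes :: "'a \<Rightarrow> 'a \<Rightarrow> 'a"  (infixr "\<otimes>" 75) where
  "X \<otimes> Y = vset {vpair x y | x y. x \<in> elts X \<and> y \<in> elts Y}"

definition vlam :: "'a \<Rightarrow> ('a \<Rightarrow> 'a) \<Rightarrow> 'a" where
  "vlam X f = vset {vpair x (f x) | x. x \<in> elts X}"

definition app :: "'a \<Rightarrow> 'a \<Rightarrow> 'a"  (infixl "\<cdot>" 80) where
  "f \<cdot> x = (THE y. vpair x y \<in> elts f)"

definition vexp :: "'a \<Rightarrow> 'a \<Rightarrow> 'a"  (infixr "\<up>" 85) where
  "Y \<up> X = vset {vlam X f | f. f \<in> elts X \<rightarrow> elts Y}"

definition vcomp :: "'a \<Rightarrow> 'a \<Rightarrow> 'a"  (infixr "\<odot>" 78) where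
  "g \<odot> f = vset {vpair x z | x z. \<exists>y. vpair x y \<in> elts f \<and> vpair y z \<in> elts g}"

definition small :: "'a set \<Rightarrow> bool" where
  "small S \<longleftrightarrow> S \<in> range elts"

lemma small_elts [simp]: "small (elts x)"
  by (simp add: small_def)

lemma elts_vset [simp]: "small S \<Longrightarrow> elts (vset S) = S"
  unfolding small_def vset_def by (rule f_inv_into_f)

lemma vset_elts [simp]: "vset (elts x) = x"
  unfolding vset_def using elts_inj by (rule inv_f_f)

lemma elts_eqI: "elts x = elts y \<Longrightarrow> x = y"
  using elts_inj by (rule injD)

lemma small_subset: "small T \<Longrightarrow> S \<subseteq> T \<Longrightarrow> small S"
  unfolding small_def using elts_separation by blast

lemma small_image: "small S \<Longrightarrow> small (f ` S)"
  unfolding small_def using elts_replacement by auto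

lemma small_UN:
  assumes "small S" and "\<And>x. x \<in> S \<Longrightarrow> small (T x)"
  shows "small (\<Union>x\<in>S. T x)"
proof -
  have "(\<Union>x\<in>S. T x) = (\<Union>y\<in>elts (vset ((\<lambda>x. vset (T x)) ` S)). elts y)"
    using assms by (simp add: small_image)
  then show ?thesis
    using elts_union unfolding small_def by simp
qed

lemma small_Pow: "small {y. elts y \<subseteq> elts x}"
  unfolding small_def by (rule elts_power)

lemma small_empty [simp]: "small {}"
  by (rule small_subset[OF small_elts]) simp

lemma small_doubleton [simp]: "small {x, y}"
proof -
  define e where "e = vset {}"
  define p where "p = vset {z. elts z \<subseteq> elts e}"
  have e: "elts e = {}" by (simp add: e_def)
  have p: "elts p = {e}"
    using e small_Pow[of e] elts_eqI unfolding p_def by (simp, blast)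
  have ep: "e \<noteq> p" using e p by force
  have "{e, p} \<subseteq> {z. elts z \<subseteq> elts p}"
    using e p by auto
  then have "small {e, p}"
    by (rule small_subset[OF small_Pow])
  then have "small ((\<lambda>z. if z = e then x else y) ` {e, p})"
    by (rule small_image)
  moreover have "(\<lambda>z. if z = e then x else y) ` {e, p} = {x, y}"
    using ep by auto
  ultimately show ?thesis by simp
qed

lemma small_singleton [simp]: "small {x}"
  using small_doubleton[of x x] by simp

lemma vpair_eq_iff [simp]: "vpair x y = vpair x' y' \<longleftrightarrow> x = x' \<and> y = y'"
proof
  assume "vpair x y = vpair x' y'"
  then have "elts (vpair x y) = elts (vpair x' y')"
    by simp
  then have "{vset {x}, vset {x, y}} = {vset {x'}, vset {x', y'}}"
    by (simp add: vpair_def)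
  then have "elts ` {vset {x}, vset {x, y}} = elts ` {vset {x'}, vset {x', y'}}"
    by (rule arg_cong)
  then have "{{x}, {x, y}} = {{x'}, {x', y'}}"
    by simp
  then show "x = x' \<and> y = y'"
    by (auto simp: doubleton_eq_iff)
qed simp

lemma vfst_vpair [simp]: "vfst (vpair x y) = x"
  and vsnd_vpair [simp]: "vsnd (vpair x y) = y"
  by (auto simp: vfst_def vsnd_def)

lemma elts_vtimes: "elts (X \<otimes> Y) = {vpair x y | x y. x \<in> elts X \<and> y \<in> elts Y}"
proof -
  have "{vpair x y | x y. x \<in> elts X \<and> y \<in> elts Y} = (\<Union>x\<in>elts X. (\<lambda>y. vpair x y) ` elts Y)"
    by auto
  then show ?thesis
    unfolding vtimes_def by (simp add: small_UN small_image)
qed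

lemma elts_vlam: "elts (vlam X f) = {vpair x (f x) | x. x \<in> elts X}"
proof -
  have "{vpair x (f x) | x. x \<in> elts X} = (\<lambda>x. vpair x (f x)) ` elts X"
    by auto
  then show ?thesis
    unfolding vlam_def by (simp add: small_image)
qed

lemma app_vlam [simp]: "x \<in> elts X \<Longrightarrow> vlam X f \<cdot> x = f x"
  by (simp add: app_def elts_vlam)

lemma elts_vexp: "elts (Y \<up> X) = {vlam X f | f. f \<in> elts X \<rightarrow> elts Y}"
proof -
  have "{vlam X f | f. f \<in> elts X \<rightarrow> elts Y} \<subseteq> {z. elts z \<subseteq> elts (X \<otimes> Y)}"
    by (auto simp: elts_vlam elts_vtimes Pi_def)
  then show ?thesis
    unfolding vexp_def by (simp add: small_subset[OF small_Pow])
qed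

lemma vcomp_vlam:
  assumes "f \<in> elts X \<rightarrow> elts Y"
  shows "vlam Y g \<odot> vlam X f = vlam X (\<lambda>x. g (f x))"
proof -
  have "{vpair x z | x z. \<exists>y. vpair x y \<in> elts (vlam X f) \<and> vpair y z \<in> elts (vlam Y g)}
      = {vpair x (g (f x)) | x. x \<in> elts X}"
    using assms by (auto simp: elts_vlam)
  then show ?thesis
    by (simp add: vcomp_def vlam_def)
qed

text \<open>\<open>id\<^sub>A \<times> g : A \<times> X \<rightarrow> A \<times> Y\<close> for \<open>g : X \<rightarrow> Y\<close>, and \<open>g\<^sup>B : X\<^sup>B \<rightarrow> Y\<^sup>B\<close> for \<open>g : X \<rightarrow> Y\<close>.\<close>

definition id_times :: "'a \<Rightarrow> 'a \<Rightarrow> 'a \<Rightarrow> 'a" where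
  "id_times A X g = vlam (A \<otimes> X) (\<lambda>p. vpair (vfst p) (g \<cdot> vsnd p))"

definition exp_map :: "'a \<Rightarrow> 'a \<Rightarrow> 'a \<Rightarrow> 'a" where
  "exp_map B X g = vlam (X \<up> B) (\<lambda>t. g \<odot> t)"

end


section \<open>Categories, functors and natural transformations\<close>

text \<open>
  The hom-sets need not be disjoint, so a morphism does not determine its domain and codomain and
  the morphism part of a functor takes them as arguments. (For the category of sets this matters:
  one and the same set of pairs is a function into any superset of its range.)
\<close>

record ('o, 'm) category =
  Ob :: "'o set"
  Hom :: "'o \<Rightarrow> 'o \<Rightarrow> 'm set"
  Id :: "'o \<Rightarrow> 'm"
  Comp :: "'m \<Rightarrow> 'm \<Rightarrow> 'm"  (infixr "\<circ>\<index>" 78)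

definition is_category :: "('o, 'm) category \<Rightarrow> bool" where
  "is_category C \<longleftrightarrow>
    (\<forall>a\<in>Ob C. Id C a \<in> Hom C a a) \<and>
    (\<forall>a\<in>Ob C. \<forall>b\<in>Ob C. \<forall>c\<in>Ob C. \<forall>f\<in>Hom C a b. \<forall>g\<in>Hom C b c. g \<circ>\<^bsub>C\<^esub> f \<in> Hom C a c) \<and>
    (\<forall>a\<in>Ob C. \<forall>b\<in>Ob C. \<forall>f\<in>Hom C a b. f \<circ>\<^bsub>C\<^esub> Id C a = f \<and> Id C b \<circ>\<^bsub>C\<^esub> f = f) \<and>
    (\<forall>a\<in>Ob C. \<forall>b\<in>Ob C. \<forall>c\<in>Ob C. \<forall>d\<in>Ob C.
      \<forall>f\<in>Hom C a b. \<forall>g\<in>Hom C b c. \<forall>h\<in>Hom C c d.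
        (h \<circ>\<^bsub>C\<^esub> g) \<circ>\<^bsub>C\<^esub> f = h \<circ>\<^bsub>C\<^esub> (g \<circ>\<^bsub>C\<^esub> f))"

record ('o, 'm, 'p, 'n) ftor =
  fob :: "'o \<Rightarrow> 'p"
  far :: "'o \<Rightarrow> 'o \<Rightarrow> 'm \<Rightarrow> 'n"

text \<open>
  Functors and natural transformations take a fixed value outside the source category, so that
  equality in HOL is equality of functors and of natural transformations. \<open>mk_functor\<close> and
  \<open>restrict\<close> enforce this.
\<close>

definition mk_functor ::
  "('o, 'm) category \<Rightarrow> ('o \<Rightarrow> 'p) \<Rightarrow> ('o \<Rightarrow> 'o \<Rightarrow> 'm \<Rightarrow> 'n) \<Rightarrow> ('o, 'm, 'p, 'n) ftor" where
  "mk_functor C F0 F1 =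
    \<lparr>fob = restrict F0 (Ob C),
     far = (\<lambda>a b f. if a \<in> Ob C \<and> b \<in> Ob C \<and> f \<in> Hom C a b then F1 a b f else undefined)\<rparr>"

definition is_functor ::
  "('o, 'm) category \<Rightarrow> ('p, 'n) category \<Rightarrow> ('o, 'm, 'p, 'n) ftor \<Rightarrow> bool" where
  "is_functor C D F \<longleftrightarrow>
    is_category C \<and> is_category D \<and>
    (\<forall>a\<in>Ob C. fob F a \<in> Ob D) \<and>
    (\<forall>a\<in>Ob C. \<forall>b\<in>Ob C. \<forall>f\<in>Hom C a b. far F a b f \<in> Hom D (fob F a) (fob F b)) \<and>
    (\<forall>a\<in>Ob C. far F a a (Id C a) = Id D (fob F a)) \<and>
    (\<forall>a\<in>Ob C. \<forall>b\<in>Ob C. \<forall>c\<in>Ob C. \<forall>f\<in>Hom C a b. \<forall>g\<in>Hom C b c.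
      far F a c (g \<circ>\<^bsub>C\<^esub> f) = far F b c g \<circ>\<^bsub>D\<^esub> far F a b f) \<and>
    F = mk_functor C (fob F) (far F)"

definition id_functor :: "('o, 'm) category \<Rightarrow> ('o, 'm, 'o, 'm) ftor" where
  "id_functor C = mk_functor C (\<lambda>a. a) (\<lambda>a b f. f)"

definition comp_functor ::
  "('o, 'm) category \<Rightarrow> ('p, 'n, 'q, 'l) ftor \<Rightarrow> ('o, 'm, 'p, 'n) ftor \<Rightarrow> ('o, 'm, 'q, 'l) ftor" where
  "comp_functor C G F =
    mk_functor C (\<lambda>a. fob G (fob F a)) (\<lambda>a b f. far G (fob F a) (fob F b) (far F a b f))"

definition is_nat_trans ::
  "('o, 'm) category \<Rightarrow> ('p, 'n) category \<Rightarrow> ('o, 'm, 'p, 'n) ftor \<Rightarrow> ('o, 'm, 'p, 'n) ftor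
    \<Rightarrow> ('o \<Rightarrow> 'n) \<Rightarrow> bool" where
  "is_nat_trans C D F G \<alpha> \<longleftrightarrow>
    is_functor C D F \<and> is_functor C D G \<and>
    (\<forall>a\<in>Ob C. \<alpha> a \<in> Hom D (fob F a) (fob G a)) \<and>
    (\<forall>a\<in>Ob C. \<forall>b\<in>Ob C. \<forall>f\<in>Hom C a b. \<alpha> b \<circ>\<^bsub>D\<^esub> far F a b f = far G a b f \<circ>\<^bsub>D\<^esub> \<alpha> a) \<and>
    \<alpha> \<in> extensional (Ob C)"

definition vert_comp ::
  "('o, 'm) category \<Rightarrow> ('p, 'n) category \<Rightarrow> ('o \<Rightarrow> 'n) \<Rightarrow> ('o \<Rightarrow> 'n) \<Rightarrow> ('o \<Rightarrow> 'n)" where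
  "vert_comp C D \<beta> \<alpha> = (\<lambda>a\<in>Ob C. \<beta> a \<circ>\<^bsub>D\<^esub> \<alpha> a)"

text \<open>The whiskerings \<open>\<alpha>F\<close> and \<open>F\<alpha>\<close>, the latter for \<open>\<alpha> : G \<Rightarrow> H\<close>; here \<open>C\<close> is the category on
  which the resulting transformation is indexed.\<close>

definition pre_whisker ::
  "('o, 'm) category \<Rightarrow> ('p \<Rightarrow> 'n) \<Rightarrow> ('o, 'm, 'p, 'k) ftor \<Rightarrow> ('o \<Rightarrow> 'n)" where
  "pre_whisker C \<alpha> F = (\<lambda>a\<in>Ob C. \<alpha> (fob F a))"

definition post_whisker ::
  "('o, 'm) category \<Rightarrow> ('p, 'n, 'q, 'l) ftor \<Rightarrow> ('o, 'm, 'p, 'n) ftor \<Rightarrow> ('o, 'm, 'p, 'n) ftor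
    \<Rightarrow> ('o \<Rightarrow> 'n) \<Rightarrow> ('o \<Rightarrow> 'l)" where
  "post_whisker C F G H \<alpha> = (\<lambda>a\<in>Ob C. far F (fob G a) (fob H a) (\<alpha> a))"

definition functor_cat ::
  "('o, 'm) category \<Rightarrow> ('p, 'n) category \<Rightarrow> (('o, 'm, 'p, 'n) ftor, 'o \<Rightarrow> 'n) category" where
  "functor_cat C D =
    \<lparr>Ob = {F. is_functor C D F},
     Hom = (\<lambda>F G. {\<alpha>. is_nat_trans C D F G \<alpha>}),
     Id = (\<lambda>F. \<lambda>a\<in>Ob C. Id D (fob F a)),
     Comp = vert_comp C D\<rparr>"

definition is_iso_functor ::
  "('o, 'm) category \<Rightarrow> ('p, 'n) category \<Rightarrow> ('o, 'm, 'p, 'n) ftor \<Rightarrow> bool" where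
  "is_iso_functor C D F \<longleftrightarrow> is_functor C D F \<and>
    (\<exists>G. is_functor D C G \<and> comp_functor C G F = id_functor C \<and> comp_functor D F G = id_functor D)"


section \<open>Right Kan extensions, familiars, distributive laws and coalgebras\<close>

text \<open>\<open>(R, \<epsilon>)\<close> is the right Kan extension of \<open>K : C \<rightarrow> E\<close> along \<open>F : C \<rightarrow> D\<close>.\<close>

definition is_right_Kan_extension ::
  "('o, 'm) category \<Rightarrow> ('p, 'n) category \<Rightarrow> ('q, 'l) category
    \<Rightarrow> ('o, 'm, 'p, 'n) ftor \<Rightarrow> ('o, 'm, 'q, 'l) ftor
    \<Rightarrow> ('p, 'n, 'q, 'l) ftor \<Rightarrow> ('o \<Rightarrow> 'l) \<Rightarrow> bool" where
  "is_right_Kan_extension C D E F K R \<epsilon> \<longleftrightarrow>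
    is_functor C D F \<and> is_functor C E K \<and> is_functor D E R \<and>
    is_nat_trans C E (comp_functor C R F) K \<epsilon> \<and>
    (\<forall>H \<theta>. is_functor D E H \<longrightarrow> is_nat_trans C E (comp_functor C H F) K \<theta> \<longrightarrow>
      (\<exists>!\<tau>. is_nat_trans D E H R \<tau> \<and> vert_comp C E \<epsilon> (pre_whisker C \<tau> F) = \<theta>))"

text \<open>
  The familiar of an endofunctor \<open>F\<close> is the endofunctor \<open>G \<mapsto> Ran\<^sub>F (FG)\<close> of \<open>[C, C]\<close>. Its action on
  \<open>\<alpha> : G \<Rightarrow> G'\<close> is the one induced by the universal property, i.e. it is characterised by
  \<open>\<epsilon>\<^sub>G\<^sub>' \<circ> \<Phi>(\<alpha>)F = F\<alpha> \<circ> \<epsilon>\<^sub>G\<close>.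
\<close>

definition is_familiar ::
  "('o, 'm) category \<Rightarrow> ('o, 'm, 'o, 'm) ftor
    \<Rightarrow> (('o, 'm, 'o, 'm) ftor, 'o \<Rightarrow> 'm, ('o, 'm, 'o, 'm) ftor, 'o \<Rightarrow> 'm) ftor
    \<Rightarrow> (('o, 'm, 'o, 'm) ftor \<Rightarrow> 'o \<Rightarrow> 'm) \<Rightarrow> bool" where
  "is_familiar C F \<Phi> \<epsilon> \<longleftrightarrow>
    is_functor (functor_cat C C) (functor_cat C C) \<Phi> \<and>
    (\<forall>G. is_functor C C G \<longrightarrow>
      is_right_Kan_extension C C C F (comp_functor C F G) (fob \<Phi> G) (\<epsilon> G)) \<and>
    (\<forall>G G' \<alpha>. is_nat_trans C C G G' \<alpha> \<longrightarrow>
      vert_comp C C (\<epsilon> G') (pre_whisker C (far \<Phi> G G' \<alpha>) F) =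
      vert_comp C C (post_whisker C F G G' \<alpha>) (\<epsilon> G))"

definition DL ::
  "('o, 'm) category \<Rightarrow> ('o, 'm, 'o, 'm) ftor
    \<Rightarrow> (('o, 'm, 'o, 'm) ftor \<times> ('o \<Rightarrow> 'm), 'o \<Rightarrow> 'm) category" where
  "DL C F =
    \<lparr>Ob = {(\<Sigma>, l). is_functor C C \<Sigma> \<and>
             is_nat_trans C C (comp_functor C \<Sigma> F) (comp_functor C F \<Sigma>) l},
     Hom = (\<lambda>(\<Sigma>1, l1) (\<Sigma>2, l2). {\<theta>. is_nat_trans C C \<Sigma>1 \<Sigma>2 \<theta> \<and>
             vert_comp C C l2 (pre_whisker C \<theta> F) =
             vert_comp C C (post_whisker C F \<Sigma>1 \<Sigma>2 \<theta>) l1}),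
     Id = (\<lambda>(\<Sigma>, l). Id (functor_cat C C) \<Sigma>),
     Comp = vert_comp C C\<rparr>"

definition Coalg ::
  "('o, 'm) category \<Rightarrow> ('o, 'm, 'o, 'm) ftor \<Rightarrow> ('o \<times> 'm, 'm) category" where
  "Coalg C \<Phi> =
    \<lparr>Ob = {(a, \<delta>). a \<in> Ob C \<and> \<delta> \<in> Hom C a (fob \<Phi> a)},
     Hom = (\<lambda>(a1, \<delta>1) (a2, \<delta>2). {h \<in> Hom C a1 a2. far \<Phi> a1 a2 h \<circ>\<^bsub>C\<^esub> \<delta>1 = \<delta>2 \<circ>\<^bsub>C\<^esub> h}),
     Id = (\<lambda>(a, \<delta>). Id C a),
     Comp = Comp C\<rparr>"


section \<open>The category of sets and the functor \<open>A \<times> (-)\<close>\<close>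

definition SET :: "('u::set_universe, 'u) category" where
  "SET = \<lparr>Ob = UNIV, Hom = (\<lambda>X Y. elts (Y \<up> X)), Id = (\<lambda>X. vlam X (\<lambda>x. x)), Comp = vcomp\<rparr>"

type_synonym 'u endo = "('u, 'u, 'u, 'u) ftor"

definition prod_functor :: "'u::set_universe \<Rightarrow> 'u endo" where
  "prod_functor A = mk_functor SET (\<lambda>X. A \<otimes> X) (\<lambda>X Y g. id_times A X g)"

text \<open>\<open>FF A\<close> is the functor \<open>G \<mapsto> (A \<times> G(-))\<^bsup>(A\<^bsup>(-)\<^esup>)\<^esup>\<close> on \<open>[Set, Set]\<close>.\<close>

definition FF_obj :: "'u::set_universe \<Rightarrow> 'u endo \<Rightarrow> 'u endo" where
  "FF_obj A G = mk_functor SET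
    (\<lambda>X. (A \<otimes> fob G X) \<up> (A \<up> X))
    (\<lambda>X Y h. vlam ((A \<otimes> fob G X) \<up> (A \<up> X)) (\<lambda>\<phi>. vlam (A \<up> Y) (\<lambda>\<sigma>.
       id_times A (fob G X) (far G X Y h) \<cdot> (\<phi> \<cdot> (\<sigma> \<odot> h)))))"

definition FF :: "'u::set_universe \<Rightarrow> ('u endo, 'u \<Rightarrow> 'u, 'u endo, 'u \<Rightarrow> 'u) ftor" where
  "FF A = mk_functor (functor_cat SET SET) (FF_obj A)
    (\<lambda>G G' \<alpha> X. exp_map (A \<up> X) (A \<otimes> fob G X) (id_times A (fob G X) (\<alpha> X)))"

definition eps :: "'u::set_universe \<Rightarrow> 'u endo \<Rightarrow> 'u \<Rightarrow> 'u" where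
  "eps A G X =
    (let p1 = vlam (A \<otimes> X) vfst; p2 = vlam (A \<otimes> X) vsnd in
      vlam ((A \<otimes> fob G (A \<otimes> X)) \<up> (A \<up> (A \<otimes> X))) (\<lambda>\<phi>.
        id_times A (fob G (A \<otimes> X)) (far G (A \<otimes> X) X p2) \<cdot> (\<phi> \<cdot> p1)))"

definition costrength :: "'u::set_universe endo \<Rightarrow> 'u \<Rightarrow> 'u \<Rightarrow> 'u" where
  "costrength H B Y = vlam (fob H (Y \<up> B)) (\<lambda>t. vlam B (\<lambda>b.
     far H (Y \<up> B) Y (vlam (Y \<up> B) (\<lambda>g. g \<cdot> b)) \<cdot> t))"

definition cmap :: "'u::set_universe \<Rightarrow> 'u \<Rightarrow> 'u" where
  "cmap A X = vlam X (\<lambda>x. vlam (A \<up> X) (\<lambda>\<sigma>. vpair (\<sigma> \<cdot> x) x))"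

text \<open>\<open>hat A H \<theta>\<close> is the transpose of \<open>\<theta> : HF \<Rightarrow> FG\<close>; it does not depend on \<open>G\<close>.\<close>

definition hat :: "'u::set_universe \<Rightarrow> 'u endo \<Rightarrow> ('u \<Rightarrow> 'u) \<Rightarrow> 'u \<Rightarrow> 'u" where
  "hat A H \<theta> X =
    exp_map (A \<up> X) (fob H (A \<otimes> X)) (\<theta> X)
    \<odot> costrength H (A \<up> X) (A \<otimes> X)
    \<odot> far H X ((A \<otimes> X) \<up> (A \<up> X)) (cmap A X)"

definition DL_to_Coalg ::
  "'u::set_universe \<Rightarrow> ('u endo \<times> ('u \<Rightarrow> 'u), 'u \<Rightarrow> 'u, 'u endo \<times> ('u \<Rightarrow> 'u), 'u \<Rightarrow> 'u) ftor" where
  "DL_to_Coalg A =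
    mk_functor (DL SET (prod_functor A)) (\<lambda>(\<Sigma>, l). (\<Sigma>, hat A \<Sigma> l)) (\<lambda>_ _ \<theta>. \<theta>)"

end

theory Submission
  imports Defs
begin

text \<open>
  A valuation \<open>\<sigma> : X \<rightarrow> A\<close> is the same as the section \<open>\<langle>\<sigma>, id\<rangle> : X \<rightarrow> A \<times> X\<close> of \<open>\<pi>\<^sub>2\<close>, so a transformation
  \<open>\<tau> : H \<Rightarrow> FF(G)\<close> is forced by naturality along \<open>\<langle>\<sigma>, id\<rangle>\<close> to be
  \<open>\<tau>\<^sub>X(t)(\<sigma>) = \<theta>\<^sub>X(H\<langle>\<sigma>, id\<rangle>(t))\<close> for \<open>\<theta> = \<epsilon> \<circ> \<tau>F\<close>, and the transpose of \<open>\<theta>\<close> is given by this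
  formula. The isomorphism of categories is a formal consequence of the universal property
  and holds for every familiar.
\<close>

section \<open>Categories of functors, distributive laws and coalgebras\<close>

text \<open>The formula for \<open>FF A G\<close> comes from the end formula: the right Kan
  extension of K along F, at X, is the end over Y of the maps from Set(X, FY) to KY. For FY = A x Y,
  a map X -> A x Y is a valuation together with a map X -> Y, so currying and the Yoneda lemma in Y
  leave the maps from A^X to KX; K = FG gives (A x GX)^(A^X). The first projection A x X -> A is the
  generic valuation, which is why the counit evaluates there. The universal property is checked on
  elements rather than through the end. It rests on identities between projections and sections:
  <sigma, id> o h = (id x h) o <sigma o h, id> makes the transpose natural, (id x pi2) o <pi1, id> =
  id gives existence, and pi1 o <sigma, id> = sigma with pi2 o <sigma, id> = id gives uniqueness.
  The definition of the transpose by costrength enters only through its values at an element and a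
  valuation.\<close>

lemma category_Id: "is_category C \<Longrightarrow> a \<in> Ob C \<Longrightarrow> Id C a \<in> Hom C a a"
  and category_Comp: "is_category C \<Longrightarrow> a \<in> Ob C \<Longrightarrow> b \<in> Ob C \<Longrightarrow> c \<in> Ob C \<Longrightarrow>
    f \<in> Hom C a b \<Longrightarrow> g \<in> Hom C b c \<Longrightarrow> g \<circ>\<^bsub>C\<^esub> f \<in> Hom C a c"
  and category_Id_right: "is_category C \<Longrightarrow> a \<in> Ob C \<Longrightarrow> b \<in> Ob C \<Longrightarrow> f \<in> Hom C a b \<Longrightarrow>
    f \<circ>\<^bsub>C\<^esub> Id C a = f"
  and category_Id_left: "is_category C \<Longrightarrow> a \<in> Ob C \<Longrightarrow> b \<in> Ob C \<Longrightarrow> f \<in> Hom C a b \<Longrightarrow>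
    Id C b \<circ>\<^bsub>C\<^esub> f = f"
  and category_assoc: "is_category C \<Longrightarrow> a \<in> Ob C \<Longrightarrow> b \<in> Ob C \<Longrightarrow> c \<in> Ob C \<Longrightarrow> d \<in> Ob C \<Longrightarrow>
    f \<in> Hom C a b \<Longrightarrow> g \<in> Hom C b c \<Longrightarrow> h \<in> Hom C c d \<Longrightarrow>
    (h \<circ>\<^bsub>C\<^esub> g) \<circ>\<^bsub>C\<^esub> f = h \<circ>\<^bsub>C\<^esub> (g \<circ>\<^bsub>C\<^esub> f)"
  unfolding is_category_def by blast+

lemma is_categoryI:
  assumes "\<And>a. a \<in> Ob C \<Longrightarrow> Id C a \<in> Hom C a a"
    and "\<And>a b c f g. a \<in> Ob C \<Longrightarrow> b \<in> Ob C \<Longrightarrow> c \<in> Ob C \<Longrightarrow> f \<in> Hom C a b \<Longrightarrow> g \<in> Hom C b c \<Longrightarrow>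
      g \<circ>\<^bsub>C\<^esub> f \<in> Hom C a c"
    and "\<And>a b f. a \<in> Ob C \<Longrightarrow> b \<in> Ob C \<Longrightarrow> f \<in> Hom C a b \<Longrightarrow> f \<circ>\<^bsub>C\<^esub> Id C a = f"
    and "\<And>a b f. a \<in> Ob C \<Longrightarrow> b \<in> Ob C \<Longrightarrow> f \<in> Hom C a b \<Longrightarrow> Id C b \<circ>\<^bsub>C\<^esub> f = f"
    and "\<And>a b c d f g h. a \<in> Ob C \<Longrightarrow> b \<in> Ob C \<Longrightarrow> c \<in> Ob C \<Longrightarrow> d \<in> Ob C \<Longrightarrow>
      f \<in> Hom C a b \<Longrightarrow> g \<in> Hom C b c \<Longrightarrow> h \<in> Hom C c d \<Longrightarrow>
      (h \<circ>\<^bsub>C\<^esub> g) \<circ>\<^bsub>C\<^esub> f = h \<circ>\<^bsub>C\<^esub> (g \<circ>\<^bsub>C\<^esub> f)"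
  shows "is_category C"
  unfolding is_category_def by (intro conjI ballI; rule assms; assumption)

lemma functor_source: "is_functor C D F \<Longrightarrow> is_category C"
  and functor_target: "is_functor C D F \<Longrightarrow> is_category D"
  and functor_ob: "is_functor C D F \<Longrightarrow> a \<in> Ob C \<Longrightarrow> fob F a \<in> Ob D"
  and functor_arr: "is_functor C D F \<Longrightarrow> a \<in> Ob C \<Longrightarrow> b \<in> Ob C \<Longrightarrow> f \<in> Hom C a b \<Longrightarrow>
    far F a b f \<in> Hom D (fob F a) (fob F b)"
  and functor_Id: "is_functor C D F \<Longrightarrow> a \<in> Ob C \<Longrightarrow> far F a a (Id C a) = Id D (fob F a)"
  and functor_Comp: "is_functor C D F \<Longrightarrow> a \<in> Ob C \<Longrightarrow> b \<in> Ob C \<Longrightarrow> c \<in> Ob C \<Longrightarrow>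
    f \<in> Hom C a b \<Longrightarrow> g \<in> Hom C b c \<Longrightarrow> far F a c (g \<circ>\<^bsub>C\<^esub> f) = far F b c g \<circ>\<^bsub>D\<^esub> far F a b f"
  unfolding is_functor_def by blast+

lemma nat_trans_source: "is_nat_trans C D F G \<alpha> \<Longrightarrow> is_functor C D F"
  and nat_trans_target: "is_nat_trans C D F G \<alpha> \<Longrightarrow> is_functor C D G"
  and nat_trans_component: "is_nat_trans C D F G \<alpha> \<Longrightarrow> a \<in> Ob C \<Longrightarrow> \<alpha> a \<in> Hom D (fob F a) (fob G a)"
  and nat_trans_naturality: "is_nat_trans C D F G \<alpha> \<Longrightarrow> a \<in> Ob C \<Longrightarrow> b \<in> Ob C \<Longrightarrow> f \<in> Hom C a b \<Longrightarrow>
    \<alpha> b \<circ>\<^bsub>D\<^esub> far F a b f = far G a b f \<circ>\<^bsub>D\<^esub> \<alpha> a"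
  and nat_trans_extensional: "is_nat_trans C D F G \<alpha> \<Longrightarrow> \<alpha> \<in> extensional (Ob C)"
  unfolding is_nat_trans_def by blast+

lemma fob_mk_functor [simp]: "a \<in> Ob C \<Longrightarrow> fob (mk_functor C F0 F1) a = F0 a"
  and far_mk_functor [simp]: "a \<in> Ob C \<Longrightarrow> b \<in> Ob C \<Longrightarrow> f \<in> Hom C a b \<Longrightarrow>
    far (mk_functor C F0 F1) a b f = F1 a b f"
  by (simp_all add: mk_functor_def)

lemma mk_functor_cong:
  assumes "\<And>a. a \<in> Ob C \<Longrightarrow> F0 a = G0 a"
    and "\<And>a b f. a \<in> Ob C \<Longrightarrow> b \<in> Ob C \<Longrightarrow> f \<in> Hom C a b \<Longrightarrow> F1 a b f = G1 a b f"
  shows "mk_functor C F0 F1 = mk_functor C G0 G1"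
  unfolding mk_functor_def using assms by (auto intro!: ext restrict_ext)

lemma is_functor_mk_functorI:
  assumes "is_category C" and "is_category D"
    and "\<And>a. a \<in> Ob C \<Longrightarrow> F0 a \<in> Ob D"
    and "\<And>a b f. a \<in> Ob C \<Longrightarrow> b \<in> Ob C \<Longrightarrow> f \<in> Hom C a b \<Longrightarrow> F1 a b f \<in> Hom D (F0 a) (F0 b)"
    and "\<And>a. a \<in> Ob C \<Longrightarrow> F1 a a (Id C a) = Id D (F0 a)"
    and "\<And>a b c f g. a \<in> Ob C \<Longrightarrow> b \<in> Ob C \<Longrightarrow> c \<in> Ob C \<Longrightarrow> f \<in> Hom C a b \<Longrightarrow> g \<in> Hom C b c \<Longrightarrow>
      F1 a c (g \<circ>\<^bsub>C\<^esub> f) = F1 b c g \<circ>\<^bsub>D\<^esub> F1 a b f"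
  shows "is_functor C D (mk_functor C F0 F1)"
proof -
  \<comment> \<open>The last clause of \<open>is_functor\<close> asks for canonical form: a value
    built by \<open>mk_functor\<close> is unchanged when its own components are wrapped
    again.\<close>
  have "mk_functor C F0 F1 = mk_functor C (fob (mk_functor C F0 F1)) (far (mk_functor C F0 F1))"
    by (rule mk_functor_cong) simp_all
  then show ?thesis
    unfolding is_functor_def using assms
    by (auto simp: category_Id category_Comp)
qed

lemma comp_functor_ob [simp]: "a \<in> Ob C \<Longrightarrow> fob (comp_functor C G F) a = fob G (fob F a)"
  and comp_functor_arr [simp]: "a \<in> Ob C \<Longrightarrow> b \<in> Ob C \<Longrightarrow> f \<in> Hom C a b \<Longrightarrow>
    far (comp_functor C G F) a b f = far G (fob F a) (fob F b) (far F a b f)"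
  by (simp_all add: comp_functor_def)

lemma is_functor_comp_functor:
  assumes F: "is_functor C D F" and G: "is_functor D E G"
  shows "is_functor C E (comp_functor C G F)"
  unfolding comp_functor_def
proof (rule is_functor_mk_functorI[OF functor_source[OF F] functor_target[OF G]])
  show "far G (fob F a) (fob F c) (far F a c (g \<circ>\<^bsub>C\<^esub> f)) =
      far G (fob F b) (fob F c) (far F b c g) \<circ>\<^bsub>E\<^esub> far G (fob F a) (fob F b) (far F a b f)"
    if "a \<in> Ob C" "b \<in> Ob C" "c \<in> Ob C" "f \<in> Hom C a b" "g \<in> Hom C b c" for a b c f g
    unfolding functor_Comp[OF F that]
    by (rule functor_Comp[OF G]) (use that in \<open>simp_all add: functor_ob[OF F] functor_arr[OF F]\<close>)
qed (simp_all add: functor_ob[OF F] functor_ob[OF G] functor_arr[OF F] functor_arr[OF G]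
    functor_Id[OF F] functor_Id[OF G])

section \<open>Vertical composition and whiskering\<close>

lemma is_nat_trans_vert_comp:
  assumes \<alpha>: "is_nat_trans C D F G \<alpha>" and \<beta>: "is_nat_trans C D G H \<beta>"
  shows "is_nat_trans C D F H (vert_comp C D \<beta> \<alpha>)"
proof -
  note F = nat_trans_source[OF \<alpha>] and G = nat_trans_source[OF \<beta>] and H = nat_trans_target[OF \<beta>]
  note D = functor_target[OF F]
  have "(\<beta> b \<circ>\<^bsub>D\<^esub> \<alpha> b) \<circ>\<^bsub>D\<^esub> far F a b f = far H a b f \<circ>\<^bsub>D\<^esub> \<beta> a \<circ>\<^bsub>D\<^esub> \<alpha> a"
    if "a \<in> Ob C" "b \<in> Ob C" "f \<in> Hom C a b" for a b f
  proof -
    note obs = functor_ob[OF F] functor_ob[OF G] functor_ob[OF H]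
    note homs = functor_arr[OF F] functor_arr[OF G] functor_arr[OF H]
      nat_trans_component[OF \<alpha>] nat_trans_component[OF \<beta>]
    have "(\<beta> b \<circ>\<^bsub>D\<^esub> \<alpha> b) \<circ>\<^bsub>D\<^esub> far F a b f = \<beta> b \<circ>\<^bsub>D\<^esub> \<alpha> b \<circ>\<^bsub>D\<^esub> far F a b f"
      using that by (intro category_assoc[OF D]) (rule obs homs; assumption)+
    also have "\<dots> = \<beta> b \<circ>\<^bsub>D\<^esub> far G a b f \<circ>\<^bsub>D\<^esub> \<alpha> a"
      using that by (simp add: nat_trans_naturality[OF \<alpha>])
    also have "\<dots> = (\<beta> b \<circ>\<^bsub>D\<^esub> far G a b f) \<circ>\<^bsub>D\<^esub> \<alpha> a"
      using that by (intro category_assoc[OF D, symmetric]) (rule obs homs; assumption)+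
    also have "\<dots> = (far H a b f \<circ>\<^bsub>D\<^esub> \<beta> a) \<circ>\<^bsub>D\<^esub> \<alpha> a"
      using that by (simp add: nat_trans_naturality[OF \<beta>])
    also have "\<dots> = far H a b f \<circ>\<^bsub>D\<^esub> \<beta> a \<circ>\<^bsub>D\<^esub> \<alpha> a"
      using that by (intro category_assoc[OF D]) (rule obs homs; assumption)+
    finally show ?thesis .
  qed
  moreover have "\<beta> a \<circ>\<^bsub>D\<^esub> \<alpha> a \<in> Hom D (fob F a) (fob H a)" if "a \<in> Ob C" for a
    by (rule category_Comp[OF D, where b = "fob G a"])
      (use that in \<open>simp_all add: functor_ob[OF F] functor_ob[OF G] functor_ob[OF H]
        nat_trans_component[OF \<alpha>] nat_trans_component[OF \<beta>]\<close>)
  ultimately show ?thesis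
    unfolding is_nat_trans_def vert_comp_def using F H by simp
qed

lemma is_nat_trans_pre_whisker:
  assumes \<alpha>: "is_nat_trans D E G H \<alpha>" and F: "is_functor C D F"
  shows "is_nat_trans C E (comp_functor C G F) (comp_functor C H F) (pre_whisker C \<alpha> F)"
  unfolding is_nat_trans_def pre_whisker_def
  by (simp add: is_functor_comp_functor[OF F] nat_trans_source[OF \<alpha>] nat_trans_target[OF \<alpha>]
      nat_trans_component[OF \<alpha>] nat_trans_naturality[OF \<alpha>] functor_ob[OF F] functor_arr[OF F])

lemma is_nat_trans_post_whisker:
  assumes \<alpha>: "is_nat_trans C D G H \<alpha>" and F: "is_functor D E F"
  shows "is_nat_trans C E (comp_functor C F G) (comp_functor C F H) (post_whisker C F G H \<alpha>)"
proof -
  note G = nat_trans_source[OF \<alpha>] and H = nat_trans_target[OF \<alpha>]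
  have "far F (fob G b) (fob H b) (\<alpha> b) \<circ>\<^bsub>E\<^esub> far F (fob G a) (fob G b) (far G a b f) =
      far F (fob H a) (fob H b) (far H a b f) \<circ>\<^bsub>E\<^esub> far F (fob G a) (fob H a) (\<alpha> a)"
    if "a \<in> Ob C" "b \<in> Ob C" "f \<in> Hom C a b" for a b f
    using that nat_trans_naturality[OF \<alpha> that]
    by (simp add: functor_Comp[OF F, symmetric] functor_ob[OF G] functor_ob[OF H]
        functor_arr[OF G] functor_arr[OF H] nat_trans_component[OF \<alpha>])
  then show ?thesis
    unfolding is_nat_trans_def post_whisker_def
    by (simp add: is_functor_comp_functor[OF G F] is_functor_comp_functor[OF H F]
        nat_trans_component[OF \<alpha>] functor_ob[OF G] functor_ob[OF H] functor_arr[OF F])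
qed

lemma vert_comp_assoc:
  assumes \<alpha>: "is_nat_trans C D F G \<alpha>" and \<beta>: "is_nat_trans C D G H \<beta>"
    and \<gamma>: "is_nat_trans C D H K \<gamma>"
  shows "vert_comp C D (vert_comp C D \<gamma> \<beta>) \<alpha> = vert_comp C D \<gamma> (vert_comp C D \<beta> \<alpha>)"
  unfolding vert_comp_def
proof (rule restrict_ext, simp)
  fix a assume a: "a \<in> Ob C"
  note F = nat_trans_source[OF \<alpha>] and G = nat_trans_source[OF \<beta>]
    and H = nat_trans_source[OF \<gamma>] and K = nat_trans_target[OF \<gamma>]
  show "(\<gamma> a \<circ>\<^bsub>D\<^esub> \<beta> a) \<circ>\<^bsub>D\<^esub> \<alpha> a = \<gamma> a \<circ>\<^bsub>D\<^esub> \<beta> a \<circ>\<^bsub>D\<^esub> \<alpha> a"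
    by (rule category_assoc[OF functor_target[OF F]])
      (rule a functor_ob[OF F] functor_ob[OF G] functor_ob[OF H] functor_ob[OF K]
        nat_trans_component[OF \<alpha>] nat_trans_component[OF \<beta>] nat_trans_component[OF \<gamma>])+
qed

lemma pre_whisker_vert_comp:
  assumes "is_functor C D F"
  shows "pre_whisker C (vert_comp D E \<beta> \<alpha>) F = vert_comp C E (pre_whisker C \<beta> F) (pre_whisker C \<alpha> F)"
  unfolding pre_whisker_def vert_comp_def by (rule restrict_ext) (simp add: functor_ob[OF assms])

lemma is_nat_trans_Id:
  assumes F: "is_functor C D F"
  shows "is_nat_trans C D F F (\<lambda>a\<in>Ob C. Id D (fob F a))"
proof -
  note D = functor_target[OF F]
  have "Id D (fob F b) \<circ>\<^bsub>D\<^esub> far F a b f = far F a b f \<circ>\<^bsub>D\<^esub> Id D (fob F a)"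
    if "a \<in> Ob C" "b \<in> Ob C" "f \<in> Hom C a b" for a b f
  proof -
    note rules = D functor_ob[OF F that(1)] functor_ob[OF F that(2)] functor_arr[OF F that]
    show ?thesis
      unfolding category_Id_left[OF rules] category_Id_right[OF rules] ..
  qed
  then show ?thesis
    unfolding is_nat_trans_def by (simp add: F category_Id[OF D] functor_ob[OF F])
qed

lemma vert_comp_Id:
  assumes \<alpha>: "is_nat_trans C D F G \<alpha>"
  shows vert_comp_Id_left: "vert_comp C D (\<lambda>a\<in>Ob C. Id D (fob G a)) \<alpha> = \<alpha>"
    and vert_comp_Id_right: "vert_comp C D \<alpha> (\<lambda>a\<in>Ob C. Id D (fob F a)) = \<alpha>"
proof -
  have "Id D (fob G a) \<circ>\<^bsub>D\<^esub> \<alpha> a = \<alpha> a \<and> \<alpha> a \<circ>\<^bsub>D\<^esub> Id D (fob F a) = \<alpha> a" if a: "a \<in> Ob C" for a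
  proof -
    note rules = functor_target[OF nat_trans_source[OF \<alpha>]] functor_ob[OF nat_trans_source[OF \<alpha>] a]
      functor_ob[OF nat_trans_target[OF \<alpha>] a] nat_trans_component[OF \<alpha> a]
    show ?thesis
      using category_Id_left[OF rules] category_Id_right[OF rules] by blast
  qed
  then show "vert_comp C D (\<lambda>a\<in>Ob C. Id D (fob G a)) \<alpha> = \<alpha>"
    and "vert_comp C D \<alpha> (\<lambda>a\<in>Ob C. Id D (fob F a)) = \<alpha>"
    using nat_trans_extensional[OF \<alpha>] unfolding vert_comp_def
    by (auto intro!: extensionalityI[of _ "Ob C"])
qed

section \<open>Functor categories and categories of coalgebras\<close>

lemma functor_cat_simps [simp]:
  "Ob (functor_cat C D) = {F. is_functor C D F}"
  "Hom (functor_cat C D) F G = {\<alpha>. is_nat_trans C D F G \<alpha>}"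
  "Id (functor_cat C D) F = (\<lambda>a\<in>Ob C. Id D (fob F a))"
  "\<beta> \<circ>\<^bsub>functor_cat C D\<^esub> \<alpha> = vert_comp C D \<beta> \<alpha>"
  by (simp_all add: functor_cat_def)

lemma is_category_functor_cat: "is_category (functor_cat C D)"
  by (rule is_categoryI; simp)
    (erule is_nat_trans_Id, erule (1) is_nat_trans_vert_comp, erule vert_comp_Id_right,
      erule vert_comp_Id_left, erule (2) vert_comp_assoc)

lemma is_category_Coalg:
  assumes \<Phi>: "is_functor C C \<Phi>"
  shows "is_category (Coalg C \<Phi>)"
proof -
  note C = functor_source[OF \<Phi>]
  \<comment> \<open>The two coalgebra squares are pasted along the structure \<eta> of the middle
    object.\<close>
  have comp: "far \<Phi> a c (g \<circ>\<^bsub>C\<^esub> f) \<circ>\<^bsub>C\<^esub> \<delta> = \<zeta> \<circ>\<^bsub>C\<^esub> g \<circ>\<^bsub>C\<^esub> f"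
    if obs: "a \<in> Ob C" "b \<in> Ob C" "c \<in> Ob C" and homs: "f \<in> Hom C a b" "g \<in> Hom C b c"
      and coalgs: "\<delta> \<in> Hom C a (fob \<Phi> a)" "\<eta> \<in> Hom C b (fob \<Phi> b)" "\<zeta> \<in> Hom C c (fob \<Phi> c)"
      and f: "far \<Phi> a b f \<circ>\<^bsub>C\<^esub> \<delta> = \<eta> \<circ>\<^bsub>C\<^esub> f" and g: "far \<Phi> b c g \<circ>\<^bsub>C\<^esub> \<eta> = \<zeta> \<circ>\<^bsub>C\<^esub> g"
    for a b c f g \<delta> \<eta> \<zeta>
  proof -
    note \<Phi>_obs = obs[THEN functor_ob[OF \<Phi>]]
    note \<Phi>f = functor_arr[OF \<Phi> obs(1,2) homs(1)] and \<Phi>g = functor_arr[OF \<Phi> obs(2,3) homs(2)]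
    have "far \<Phi> a c (g \<circ>\<^bsub>C\<^esub> f) \<circ>\<^bsub>C\<^esub> \<delta> = (far \<Phi> b c g \<circ>\<^bsub>C\<^esub> far \<Phi> a b f) \<circ>\<^bsub>C\<^esub> \<delta>"
      using functor_Comp[OF \<Phi> obs homs] by simp
    also have "\<dots> = far \<Phi> b c g \<circ>\<^bsub>C\<^esub> far \<Phi> a b f \<circ>\<^bsub>C\<^esub> \<delta>"
      by (rule category_assoc[OF C obs(1) \<Phi>_obs coalgs(1) \<Phi>f \<Phi>g])
    also have "\<dots> = far \<Phi> b c g \<circ>\<^bsub>C\<^esub> \<eta> \<circ>\<^bsub>C\<^esub> f"
      by (simp add: f)
    also have "\<dots> = (far \<Phi> b c g \<circ>\<^bsub>C\<^esub> \<eta>) \<circ>\<^bsub>C\<^esub> f"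
      by (rule category_assoc[OF C obs(1,2) \<Phi>_obs(2,3) homs(1) coalgs(2) \<Phi>g, symmetric])
    also have "\<dots> = (\<zeta> \<circ>\<^bsub>C\<^esub> g) \<circ>\<^bsub>C\<^esub> f"
      by (simp add: g)
    also have "\<dots> = \<zeta> \<circ>\<^bsub>C\<^esub> g \<circ>\<^bsub>C\<^esub> f"
      by (rule category_assoc[OF C obs \<Phi>_obs(3) homs coalgs(3)])
    finally show ?thesis .
  qed
  have id: "far \<Phi> a a (Id C a) \<circ>\<^bsub>C\<^esub> \<delta> = \<delta> \<circ>\<^bsub>C\<^esub> Id C a"
    if "a \<in> Ob C" "\<delta> \<in> Hom C a (fob \<Phi> a)" for a \<delta>
    using that functor_ob[OF \<Phi>]
    by (simp add: functor_Id[OF \<Phi>] category_Id_left[OF C, of a "fob \<Phi> a"]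
        category_Id_right[OF C, of a "fob \<Phi> a"])
  show ?thesis
  proof (rule is_categoryI)
    show "Id (Coalg C \<Phi>) a \<in> Hom (Coalg C \<Phi>) a a" if "a \<in> Ob (Coalg C \<Phi>)" for a
      using that by (auto simp: Coalg_def category_Id[OF C] id)
    show "g \<circ>\<^bsub>Coalg C \<Phi>\<^esub> f \<in> Hom (Coalg C \<Phi>) a c"
      if "a \<in> Ob (Coalg C \<Phi>)" "b \<in> Ob (Coalg C \<Phi>)" "c \<in> Ob (Coalg C \<Phi>)"
        "f \<in> Hom (Coalg C \<Phi>) a b" "g \<in> Hom (Coalg C \<Phi>) b c" for a b c f g
      \<comment> \<open>Objects of \<open>Coalg\<close> are pairs and its \<open>Hom\<close> is
        defined by pattern matching, so the facts about \<open>C\<close> are instantiated at the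
        projections.\<close>
      using that category_Comp[OF C, of "fst a" "fst b" "fst c" f g]
        comp[of "fst a" "fst b" "fst c" f g "snd a" "snd b" "snd c"]
      by (auto simp: Coalg_def)
    show "(h \<circ>\<^bsub>Coalg C \<Phi>\<^esub> g) \<circ>\<^bsub>Coalg C \<Phi>\<^esub> f = h \<circ>\<^bsub>Coalg C \<Phi>\<^esub> g \<circ>\<^bsub>Coalg C \<Phi>\<^esub> f"
      if "a \<in> Ob (Coalg C \<Phi>)" "b \<in> Ob (Coalg C \<Phi>)" "c \<in> Ob (Coalg C \<Phi>)" "d \<in> Ob (Coalg C \<Phi>)"
        "f \<in> Hom (Coalg C \<Phi>) a b" "g \<in> Hom (Coalg C \<Phi>) b c" "h \<in> Hom (Coalg C \<Phi>) c d" for a b c d f g h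
      using that category_assoc[OF C, of "fst a" "fst b" "fst c" "fst d" f g h]
      by (auto simp: Coalg_def)
  qed (auto simp: Coalg_def intro: category_Id_left[OF C] category_Id_right[OF C])
qed

text \<open>When corresponding hom-sets are literally the same set, the inverse functor is the
  inverse bijection on objects with arrows left alone. Distributive laws and coalgebras are in this
  situation: on both sides an arrow is a natural transformation, and only the condition imposed on
  it differs.\<close>

lemma is_iso_functor_identity_on_arrows:
  assumes C: "is_category C" and D: "is_category D" and f: "bij_betw f (Ob C) (Ob D)"
    and Hom: "\<And>a b. a \<in> Ob C \<Longrightarrow> b \<in> Ob C \<Longrightarrow> Hom C a b = Hom D (f a) (f b)"
    and Id: "\<And>a. a \<in> Ob C \<Longrightarrow> Id C a = Id D (f a)"
    and Comp: "Comp C = Comp D"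
  shows "is_iso_functor C D (mk_functor C f (\<lambda>_ _ h. h))"
proof -
  define g where "g = inv_into (Ob C) f"
  have f_ob: "f a \<in> Ob D" if "a \<in> Ob C" for a
    using f that by (auto simp: bij_betw_def)
  have g_ob: "g b \<in> Ob C" if "b \<in> Ob D" for b
    unfolding g_def using f that by (metis bij_betw_def inv_into_into)
  have gf: "g (f a) = a" if "a \<in> Ob C" for a
    unfolding g_def using f that by (rule bij_betw_inv_into_left)
  have fg: "f (g b) = b" if "b \<in> Ob D" for b
    unfolding g_def using f that by (rule bij_betw_inv_into_right)
  have "is_functor C D (mk_functor C f (\<lambda>_ _ h. h))"
    by (rule is_functor_mk_functorI[OF C D]) (auto simp: f_ob Hom Id Comp)
  moreover have "is_functor D C (mk_functor D g (\<lambda>_ _ h. h))"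
    by (rule is_functor_mk_functorI[OF D C]) (auto simp: g_ob Hom Id Comp fg)
  moreover have "comp_functor C (mk_functor D g (\<lambda>_ _ h. h)) (mk_functor C f (\<lambda>_ _ h. h)) = id_functor C"
    unfolding comp_functor_def id_functor_def by (rule mk_functor_cong) (auto simp: f_ob gf Hom)
  moreover have "comp_functor D (mk_functor C f (\<lambda>_ _ h. h)) (mk_functor D g (\<lambda>_ _ h. h)) = id_functor D"
    unfolding comp_functor_def id_functor_def by (rule mk_functor_cong) (auto simp: g_ob fg Hom)
  ultimately show ?thesis
    unfolding is_iso_functor_def by blast
qed

section \<open>Whiskering laws, uniqueness for Kan extensions, distributive laws\<close>

lemma post_whisker_Id:
  assumes F: "is_functor D E F" and G: "is_functor C D G"
  shows "post_whisker C F G G (\<lambda>a\<in>Ob C. Id D (fob G a)) = (\<lambda>a\<in>Ob C. Id E (fob (comp_functor C F G) a))"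
  unfolding post_whisker_def
  by (rule restrict_ext) (simp add: functor_Id[OF F] functor_ob[OF G])

lemma pre_whisker_Id:
  assumes F: "is_functor C D F"
  shows "pre_whisker C (\<lambda>a\<in>Ob D. Id E (fob G a)) F = (\<lambda>a\<in>Ob C. Id E (fob (comp_functor C G F) a))"
  unfolding pre_whisker_def
  by (rule restrict_ext) (simp add: functor_ob[OF F])

lemma post_whisker_vert_comp:
  assumes F: "is_functor D E F" and \<alpha>: "is_nat_trans C D G H \<alpha>" and \<beta>: "is_nat_trans C D H K \<beta>"
  shows "post_whisker C F G K (vert_comp C D \<beta> \<alpha>) =
    vert_comp C E (post_whisker C F H K \<beta>) (post_whisker C F G H \<alpha>)"
  unfolding post_whisker_def vert_comp_def
  by (rule restrict_ext)
    (simp add: functor_Comp[OF F, of "fob G _" "fob H _" "fob K _"]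
      functor_ob[OF nat_trans_source[OF \<alpha>]] functor_ob[OF nat_trans_source[OF \<beta>]]
      functor_ob[OF nat_trans_target[OF \<beta>]] nat_trans_component[OF \<alpha>] nat_trans_component[OF \<beta>])

text \<open>The uniqueness half of the universal property, applied to the transformation that \<tau>
  itself induces: \<sigma> and \<tau> are then two factorizations of the same thing. Equations
  between transformations into a Kan extension can thus be tested after composing with the
  counit.\<close>

lemma right_Kan_extension_cancel:
  assumes kan: "is_right_Kan_extension C D E F K R \<epsilon>"
    and \<sigma>: "is_nat_trans D E H R \<sigma>" and \<tau>: "is_nat_trans D E H R \<tau>"
    and eq: "vert_comp C E \<epsilon> (pre_whisker C \<sigma> F) = vert_comp C E \<epsilon> (pre_whisker C \<tau> F)"
  shows "\<sigma> = \<tau>"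
proof -
  have F: "is_functor C D F" and \<epsilon>: "is_nat_trans C E (comp_functor C R F) K \<epsilon>"
    using kan by (simp_all add: is_right_Kan_extension_def)
  have "is_nat_trans C E (comp_functor C H F) K (vert_comp C E \<epsilon> (pre_whisker C \<tau> F))"
    by (rule is_nat_trans_vert_comp[OF is_nat_trans_pre_whisker[OF \<tau> F] \<epsilon>])
  then have "\<exists>!\<rho>. is_nat_trans D E H R \<rho> \<and>
      vert_comp C E \<epsilon> (pre_whisker C \<rho> F) = vert_comp C E \<epsilon> (pre_whisker C \<tau> F)"
    using kan nat_trans_source[OF \<tau>] by (simp add: is_right_Kan_extension_def)
  then show ?thesis
    using \<sigma> \<tau> eq by blast
qed

lemma is_category_DL:
  assumes F: "is_functor C C F"
  shows "is_category (DL C F)"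
proof -
  have id: "vert_comp C C l (pre_whisker C (\<lambda>a\<in>Ob C. Id C (fob \<Sigma> a)) F) =
      vert_comp C C (post_whisker C F \<Sigma> \<Sigma> (\<lambda>a\<in>Ob C. Id C (fob \<Sigma> a))) l"
    if \<Sigma>: "is_functor C C \<Sigma>"
      and l: "is_nat_trans C C (comp_functor C \<Sigma> F) (comp_functor C F \<Sigma>) l" for \<Sigma> l
    by (simp only: pre_whisker_Id[OF F] post_whisker_Id[OF F \<Sigma>]
        vert_comp_Id_left[OF l] vert_comp_Id_right[OF l])
  \<comment> \<open>The two morphism squares are pasted along \<open>l2\<close>: first
    \<open>l3\<close> moves across \<beta>, then \<open>l2\<close> across \<alpha>.\<close>
  have comp: "vert_comp C C l3 (pre_whisker C (vert_comp C C \<beta> \<alpha>) F) =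
      vert_comp C C (post_whisker C F \<Sigma>1 \<Sigma>3 (vert_comp C C \<beta> \<alpha>)) l1"
    if l: "is_nat_trans C C (comp_functor C \<Sigma>1 F) (comp_functor C F \<Sigma>1) l1"
        "is_nat_trans C C (comp_functor C \<Sigma>2 F) (comp_functor C F \<Sigma>2) l2"
        "is_nat_trans C C (comp_functor C \<Sigma>3 F) (comp_functor C F \<Sigma>3) l3"
      and \<alpha>: "is_nat_trans C C \<Sigma>1 \<Sigma>2 \<alpha>" and \<beta>: "is_nat_trans C C \<Sigma>2 \<Sigma>3 \<beta>"
      and eqs: "vert_comp C C l2 (pre_whisker C \<alpha> F) = vert_comp C C (post_whisker C F \<Sigma>1 \<Sigma>2 \<alpha>) l1"
        "vert_comp C C l3 (pre_whisker C \<beta> F) = vert_comp C C (post_whisker C F \<Sigma>2 \<Sigma>3 \<beta>) l2"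
    for \<Sigma>1 \<Sigma>2 \<Sigma>3 l1 l2 l3 \<alpha> \<beta>
  proof -
    note pre = is_nat_trans_pre_whisker[OF \<alpha> F] is_nat_trans_pre_whisker[OF \<beta> F]
    note post = is_nat_trans_post_whisker[OF \<alpha> F] is_nat_trans_post_whisker[OF \<beta> F]
    have "vert_comp C C l3 (pre_whisker C (vert_comp C C \<beta> \<alpha>) F) =
        vert_comp C C (vert_comp C C l3 (pre_whisker C \<beta> F)) (pre_whisker C \<alpha> F)"
      by (simp only: pre_whisker_vert_comp[OF F] vert_comp_assoc[OF pre l(3)])
    also have "\<dots> = vert_comp C C (post_whisker C F \<Sigma>2 \<Sigma>3 \<beta>) (vert_comp C C l2 (pre_whisker C \<alpha> F))"
      by (simp only: eqs(2) vert_comp_assoc[OF pre(1) l(2) post(2)])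
    also have "\<dots> = vert_comp C C (post_whisker C F \<Sigma>1 \<Sigma>3 (vert_comp C C \<beta> \<alpha>)) l1"
      by (simp only: eqs(1) post_whisker_vert_comp[OF F \<alpha> \<beta>] vert_comp_assoc[OF l(1) post])
    finally show ?thesis .
  qed
  show ?thesis
  proof (rule is_categoryI)
    show "Id (DL C F) a \<in> Hom (DL C F) a a" if "a \<in> Ob (DL C F)" for a
      using that by (auto simp: DL_def id is_nat_trans_Id)
    show "g \<circ>\<^bsub>DL C F\<^esub> f \<in> Hom (DL C F) a c"
      if "a \<in> Ob (DL C F)" "b \<in> Ob (DL C F)" "c \<in> Ob (DL C F)"
        "f \<in> Hom (DL C F) a b" "g \<in> Hom (DL C F) b c" for a b c f g
      using that is_nat_trans_vert_comp[of C C "fst a" "fst b" f "fst c" g]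
        comp[of "fst a" "snd a" "fst b" "snd b" "fst c" "snd c" f g]
      by (auto simp: DL_def)
    show "(h \<circ>\<^bsub>DL C F\<^esub> g) \<circ>\<^bsub>DL C F\<^esub> f = h \<circ>\<^bsub>DL C F\<^esub> g \<circ>\<^bsub>DL C F\<^esub> f"
      if "f \<in> Hom (DL C F) a b" "g \<in> Hom (DL C F) b c" "h \<in> Hom (DL C F) c d" for a b c d f g h
      using that vert_comp_assoc[of C C "fst a" "fst b" f "fst c" g "fst d" h]
      by (auto simp: DL_def split: prod.splits)
  qed (auto simp: DL_def vert_comp_Id_left vert_comp_Id_right)
qed

text \<open>
  The transposes of \<open>\<lambda>\<^sub>2 \<circ> \<theta>F\<close> and \<open>F\<theta> \<circ> \<lambda>\<^sub>1\<close> are \<open>\<delta>\<^sub>2 \<circ> \<theta>\<close> and \<open>\<Phi>(\<theta>) \<circ> \<delta>\<^sub>1\<close>, so each morphism condition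
  is the transpose of the other.
\<close>

lemma is_iso_functor_DL_Coalg:
  assumes fam: "is_familiar C F \<Phi> \<epsilon>" and F: "is_functor C C F"
    and h: "\<And>\<Sigma> l. is_functor C C \<Sigma> \<Longrightarrow>
      is_nat_trans C C (comp_functor C \<Sigma> F) (comp_functor C F \<Sigma>) l \<Longrightarrow>
      is_nat_trans C C \<Sigma> (fob \<Phi> \<Sigma>) (h \<Sigma> l) \<and> vert_comp C C (\<epsilon> \<Sigma>) (pre_whisker C (h \<Sigma> l) F) = l"
  shows "is_iso_functor (DL C F) (Coalg (functor_cat C C) \<Phi>)
    (mk_functor (DL C F) (\<lambda>(\<Sigma>, l). (\<Sigma>, h \<Sigma> l)) (\<lambda>_ _ \<theta>. \<theta>))"
proof (rule is_iso_functor_identity_on_arrows)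
  have \<Phi>: "is_functor (functor_cat C C) (functor_cat C C) \<Phi>"
    and kan: "\<And>G. is_functor C C G \<Longrightarrow>
      is_right_Kan_extension C C C F (comp_functor C F G) (fob \<Phi> G) (\<epsilon> G)"
    and \<epsilon>_nat: "\<And>G G' \<alpha>. is_nat_trans C C G G' \<alpha> \<Longrightarrow>
      vert_comp C C (\<epsilon> G') (pre_whisker C (far \<Phi> G G' \<alpha>) F) =
      vert_comp C C (post_whisker C F G G' \<alpha>) (\<epsilon> G)"
    using fam by (simp_all add: is_familiar_def)
  have \<epsilon>: "is_nat_trans C C (comp_functor C (fob \<Phi> G) F) (comp_functor C F G) (\<epsilon> G)"
    if "is_functor C C G" for G
    using kan[OF that] by (simp add: is_right_Kan_extension_def)
  \<comment> \<open>The inverse on objects: a coalgebra structure becomes a distributive law by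
    composition with the counit. That \<open>flat\<close> undoes \<open>h\<close> is the second
    conjunct of the assumption on \<open>h\<close>.\<close>
  define flat where "flat \<Sigma> \<delta> = vert_comp C C (\<epsilon> \<Sigma>) (pre_whisker C \<delta> F)" for \<Sigma> \<delta>
  have flat: "is_nat_trans C C (comp_functor C \<Sigma> F) (comp_functor C F \<Sigma>) (flat \<Sigma> \<delta>)"
    if \<Sigma>: "is_functor C C \<Sigma>" and \<delta>: "is_nat_trans C C \<Sigma> (fob \<Phi> \<Sigma>) \<delta>" for \<Sigma> \<delta>
    unfolding flat_def by (rule is_nat_trans_vert_comp[OF is_nat_trans_pre_whisker[OF \<delta> F] \<epsilon>[OF \<Sigma>]])
  \<comment> \<open>Both sides factor \<open>flat \<Sigma> \<delta>\<close> through the counit,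
    hence agree. So any choice \<open>h\<close> of factorizations yields the bijection, in
    particular one given by an explicit formula.\<close>
  have h_flat: "h \<Sigma> (flat \<Sigma> \<delta>) = \<delta>"
    if \<Sigma>: "is_functor C C \<Sigma>" and \<delta>: "is_nat_trans C C \<Sigma> (fob \<Phi> \<Sigma>) \<delta>" for \<Sigma> \<delta>
    using h[OF \<Sigma> flat[OF \<Sigma> \<delta>]]
    by (intro right_Kan_extension_cancel[OF kan[OF \<Sigma>] _ \<delta>]) (simp_all add: flat_def)
  show "is_category (DL C F)" "is_category (Coalg (functor_cat C C) \<Phi>)"
    by (rule is_category_DL[OF F], rule is_category_Coalg[OF \<Phi>])
  show "bij_betw (\<lambda>(\<Sigma>, l). (\<Sigma>, h \<Sigma> l)) (Ob (DL C F)) (Ob (Coalg (functor_cat C C) \<Phi>))"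
    by (rule bij_betw_byWitness[where f' = "\<lambda>(\<Sigma>, \<delta>). (\<Sigma>, flat \<Sigma> \<delta>)"])
      (auto simp: DL_def Coalg_def h h_flat flat, simp add: flat_def h)
  have morphism_iff: "vert_comp C C (far \<Phi> \<Sigma>1 \<Sigma>2 \<theta>) (h \<Sigma>1 l1) = vert_comp C C (h \<Sigma>2 l2) \<theta> \<longleftrightarrow>
      vert_comp C C l2 (pre_whisker C \<theta> F) = vert_comp C C (post_whisker C F \<Sigma>1 \<Sigma>2 \<theta>) l1"
    if \<Sigma>: "is_functor C C \<Sigma>1" "is_functor C C \<Sigma>2"
      and l: "is_nat_trans C C (comp_functor C \<Sigma>1 F) (comp_functor C F \<Sigma>1) l1"
        "is_nat_trans C C (comp_functor C \<Sigma>2 F) (comp_functor C F \<Sigma>2) l2"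
      and \<theta>: "is_nat_trans C C \<Sigma>1 \<Sigma>2 \<theta>"
    for \<Sigma>1 \<Sigma>2 l1 l2 \<theta>
  proof -
    have h1: "is_nat_trans C C \<Sigma>1 (fob \<Phi> \<Sigma>1) (h \<Sigma>1 l1)"
        "vert_comp C C (\<epsilon> \<Sigma>1) (pre_whisker C (h \<Sigma>1 l1) F) = l1"
      and h2: "is_nat_trans C C \<Sigma>2 (fob \<Phi> \<Sigma>2) (h \<Sigma>2 l2)"
        "vert_comp C C (\<epsilon> \<Sigma>2) (pre_whisker C (h \<Sigma>2 l2) F) = l2"
      using h[OF \<Sigma>(1) l(1)] h[OF \<Sigma>(2) l(2)] by auto
    have \<Phi>\<theta>: "is_nat_trans C C (fob \<Phi> \<Sigma>1) (fob \<Phi> \<Sigma>2) (far \<Phi> \<Sigma>1 \<Sigma>2 \<theta>)"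
      using functor_arr[OF \<Phi>] \<Sigma> \<theta> by simp
    \<comment> \<open>The counit moves past \<Phi>(\<theta>) by \<open>\<epsilon>_nat\<close>,
      turning it into F\<theta>, and then absorbs \<open>h \<Sigma>1 l1\<close> into
      \<open>l1\<close>.\<close>
    have "vert_comp C C (\<epsilon> \<Sigma>2) (pre_whisker C (vert_comp C C (far \<Phi> \<Sigma>1 \<Sigma>2 \<theta>) (h \<Sigma>1 l1)) F) =
        vert_comp C C (vert_comp C C (\<epsilon> \<Sigma>2) (pre_whisker C (far \<Phi> \<Sigma>1 \<Sigma>2 \<theta>) F))
          (pre_whisker C (h \<Sigma>1 l1) F)"
      by (simp only: pre_whisker_vert_comp[OF F] vert_comp_assoc[OF is_nat_trans_pre_whisker[OF h1(1) F]
            is_nat_trans_pre_whisker[OF \<Phi>\<theta> F] \<epsilon>[OF \<Sigma>(2)]])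
    also have "\<dots> = vert_comp C C (post_whisker C F \<Sigma>1 \<Sigma>2 \<theta>) l1"
      by (simp only: \<epsilon>_nat[OF \<theta>] h1(2) vert_comp_assoc[OF is_nat_trans_pre_whisker[OF h1(1) F]
            \<epsilon>[OF \<Sigma>(1)] is_nat_trans_post_whisker[OF \<theta> F]])
    finally have left: "vert_comp C C (\<epsilon> \<Sigma>2)
        (pre_whisker C (vert_comp C C (far \<Phi> \<Sigma>1 \<Sigma>2 \<theta>) (h \<Sigma>1 l1)) F) =
        vert_comp C C (post_whisker C F \<Sigma>1 \<Sigma>2 \<theta>) l1" .
    have right: "vert_comp C C (\<epsilon> \<Sigma>2) (pre_whisker C (vert_comp C C (h \<Sigma>2 l2) \<theta>) F) =
        vert_comp C C l2 (pre_whisker C \<theta> F)"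
      by (simp only: pre_whisker_vert_comp[OF F] h2(2) vert_comp_assoc[symmetric,
            OF is_nat_trans_pre_whisker[OF \<theta> F] is_nat_trans_pre_whisker[OF h2(1) F] \<epsilon>[OF \<Sigma>(2)]])
    show ?thesis
      using right_Kan_extension_cancel[OF kan[OF \<Sigma>(2)] is_nat_trans_vert_comp[OF h1(1) \<Phi>\<theta>]
          is_nat_trans_vert_comp[OF \<theta> h2(1)]] left right by metis
  qed
  show "Hom (DL C F) a b =
      Hom (Coalg (functor_cat C C) \<Phi>) ((\<lambda>(\<Sigma>, l). (\<Sigma>, h \<Sigma> l)) a) ((\<lambda>(\<Sigma>, l). (\<Sigma>, h \<Sigma> l)) b)"
    if "a \<in> Ob (DL C F)" "b \<in> Ob (DL C F)" for a b
    using that by (auto simp: DL_def Coalg_def morphism_iff)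
  show "Id (DL C F) a = Id (Coalg (functor_cat C C) \<Phi>) ((\<lambda>(\<Sigma>, l). (\<Sigma>, h \<Sigma> l)) a)" for a
    by (simp add: DL_def Coalg_def split: prod.split)
  show "Comp (DL C F) = Comp (Coalg (functor_cat C C) \<Phi>)"
    by (simp add: DL_def Coalg_def functor_cat_def)
qed

section \<open>The category of sets\<close>

lemma vlam_cong: "(\<And>x. x \<in> elts X \<Longrightarrow> f x = g x) \<Longrightarrow> vlam X f = vlam X g"
  by (rule elts_eqI) (auto simp: elts_vlam)

lemma vlam_in_vexp: "(\<And>x. x \<in> elts X \<Longrightarrow> f x \<in> elts Y) \<Longrightarrow> vlam X f \<in> elts (Y \<up> X)"
  by (auto simp: elts_vexp)

lemma app_in: "f \<in> elts (Y \<up> X) \<Longrightarrow> x \<in> elts X \<Longrightarrow> f \<cdot> x \<in> elts Y"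
  by (auto simp: elts_vexp)

lemma vlam_app: "f \<in> elts (Y \<up> X) \<Longrightarrow> vlam X (\<lambda>x. f \<cdot> x) = f"
  by (auto simp: elts_vexp intro!: vlam_cong)

text \<open>A function is its graph and records no codomain, so the two exponentials may have
  different bases; only the common domain matters.\<close>

lemma vexp_eqI:
  assumes "f \<in> elts (Y \<up> X)" and "g \<in> elts (Z \<up> X)" and "\<And>x. x \<in> elts X \<Longrightarrow> f \<cdot> x = g \<cdot> x"
  shows "f = g"
  using vlam_cong[of X "(\<cdot>) f" "(\<cdot>) g"] assms by (simp add: vlam_app)

lemma vcomp_eq_vlam:
  assumes "f \<in> elts (Y \<up> X)" and "g \<in> elts (Z \<up> Y)"
  shows "g \<odot> f = vlam X (\<lambda>x. g \<cdot> (f \<cdot> x))"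
proof -
  have "vlam Y ((\<cdot>) g) \<odot> vlam X ((\<cdot>) f) = vlam X (\<lambda>x. g \<cdot> (f \<cdot> x))"
    using assms by (intro vcomp_vlam) (auto simp: app_in)
  then show ?thesis
    using assms by (simp add: vlam_app)
qed

lemma vcomp_in: "f \<in> elts (Y \<up> X) \<Longrightarrow> g \<in> elts (Z \<up> Y) \<Longrightarrow> g \<odot> f \<in> elts (Z \<up> X)"
  by (simp add: vcomp_eq_vlam vlam_in_vexp app_in)

lemma vcomp_app: "f \<in> elts (Y \<up> X) \<Longrightarrow> g \<in> elts (Z \<up> Y) \<Longrightarrow> x \<in> elts X \<Longrightarrow> (g \<odot> f) \<cdot> x = g \<cdot> (f \<cdot> x)"
  by (simp add: vcomp_eq_vlam)

lemma vpair_in_vtimes [simp]: "vpair x y \<in> elts (X \<otimes> Y) \<longleftrightarrow> x \<in> elts X \<and> y \<in> elts Y"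
  by (simp add: elts_vtimes)

lemma vtimesE:
  assumes "p \<in> elts (X \<otimes> Y)"
  obtains x y where "p = vpair x y" and "x \<in> elts X" and "y \<in> elts Y"
  using assms by (auto simp: elts_vtimes)

lemma vfst_in: "p \<in> elts (X \<otimes> Y) \<Longrightarrow> vfst p \<in> elts X"
  and vsnd_in: "p \<in> elts (X \<otimes> Y) \<Longrightarrow> vsnd p \<in> elts Y"
  and vpair_vfst_vsnd: "p \<in> elts (X \<otimes> Y) \<Longrightarrow> vpair (vfst p) (vsnd p) = p"
  by (auto elim: vtimesE)

lemma id_times_in: "g \<in> elts (Y \<up> X) \<Longrightarrow> id_times A X g \<in> elts ((A \<otimes> Y) \<up> (A \<otimes> X))"
  unfolding id_times_def by (rule vlam_in_vexp) (simp add: vfst_in vsnd_in app_in)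

lemma id_times_app: "p \<in> elts (A \<otimes> X) \<Longrightarrow> id_times A X g \<cdot> p = vpair (vfst p) (g \<cdot> vsnd p)"
  by (simp add: id_times_def)

lemma exp_map_in: "g \<in> elts (Y \<up> X) \<Longrightarrow> exp_map B X g \<in> elts ((Y \<up> B) \<up> (X \<up> B))"
  unfolding exp_map_def by (rule vlam_in_vexp) (rule vcomp_in)

lemma exp_map_app:
  assumes "g \<in> elts (Y \<up> X)" and "t \<in> elts (X \<up> B)" and "b \<in> elts B"
  shows "exp_map B X g \<cdot> t \<cdot> b = g \<cdot> (t \<cdot> b)"
  using assms vcomp_app[of t X B g Y b] by (simp add: exp_map_def)

section \<open>Functors and natural transformations on sets, elementwise\<close>

lemma SET_simps [simp]:
  "Ob SET = UNIV" "Hom SET X Y = elts (Y \<up> X)" "Id SET X = vlam X (\<lambda>x. x)" "g \<circ>\<^bsub>SET\<^esub> f = g \<odot> f"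
  by (simp_all add: SET_def)

lemma is_category_SET: "is_category (SET :: ('u::set_universe, 'u) category)"
proof (rule is_categoryI)
  show "(h \<circ>\<^bsub>SET\<^esub> g) \<circ>\<^bsub>SET\<^esub> f = h \<circ>\<^bsub>SET\<^esub> (g \<circ>\<^bsub>SET\<^esub> f)"
    if "f \<in> Hom SET a b" "g \<in> Hom SET b c" "h \<in> Hom SET c d" for a b c d f g h :: 'u
    using that by (simp add: vcomp_eq_vlam[OF vcomp_in] vcomp_eq_vlam[OF _ vcomp_in] vcomp_app app_in
        cong: vlam_cong)
qed (simp_all add: vlam_in_vexp vcomp_in vcomp_eq_vlam[OF vlam_in_vexp] vcomp_eq_vlam[OF _ vlam_in_vexp]
    vlam_app app_in cong: vlam_cong)

lemma SET_arr: "is_functor SET SET G \<Longrightarrow> f \<in> elts (Y \<up> X) \<Longrightarrow> far G X Y f \<in> elts (fob G Y \<up> fob G X)"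
  using functor_arr[of SET SET G X Y f] by simp

lemma SET_arr_Id: "is_functor SET SET G \<Longrightarrow> t \<in> elts (fob G X) \<Longrightarrow> far G X X (vlam X (\<lambda>x. x)) \<cdot> t = t"
  using functor_Id[of SET SET G X] by simp

text \<open>Oriented to fuse two successive actions into one. An equation between elements of
  \<open>fob G Z\<close> then comes down to an equation between composite maps, to be settled by
  identities of projections and sections.\<close>

lemma SET_arr_Comp:
  assumes "is_functor SET SET G" and "f \<in> elts (Y \<up> X)" and "g \<in> elts (Z \<up> Y)" and "t \<in> elts (fob G X)"
  shows "far G Y Z g \<cdot> (far G X Y f \<cdot> t) = far G X Z (g \<odot> f) \<cdot> t"
  using functor_Comp[of SET SET G X Y Z f g] assms by (simp add: vcomp_app[OF SET_arr SET_arr])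

text \<open>Maps between sets are equal when they agree on elements, so the functor laws may be
  tested there; this suits functors whose arrow part is a nest of abstractions.\<close>

lemma is_functor_SET_mkI:
  assumes "\<And>X Y f. f \<in> elts (Y \<up> X) \<Longrightarrow> F1 X Y f \<in> elts (F0 Y \<up> F0 X)"
    and "\<And>X t. t \<in> elts (F0 X) \<Longrightarrow> F1 X X (vlam X (\<lambda>x. x)) \<cdot> t = t"
    and "\<And>X Y Z f g t. f \<in> elts (Y \<up> X) \<Longrightarrow> g \<in> elts (Z \<up> Y) \<Longrightarrow> t \<in> elts (F0 X) \<Longrightarrow>
      F1 X Z (g \<odot> f) \<cdot> t = F1 Y Z g \<cdot> (F1 X Y f \<cdot> t)"
  shows "is_functor SET SET (mk_functor SET F0 F1)"
proof (rule is_functor_mk_functorI[OF is_category_SET is_category_SET])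
  show "F1 X X (Id SET X) = Id SET (F0 X)" for X
    using vexp_eqI[OF assms(1)[OF vlam_in_vexp] vlam_in_vexp] by (simp add: assms(2))
  show "F1 X Z (g \<circ>\<^bsub>SET\<^esub> f) = F1 Y Z g \<circ>\<^bsub>SET\<^esub> F1 X Y f"
    if "f \<in> Hom SET X Y" "g \<in> Hom SET Y Z" for X Y Z f g
    using that vexp_eqI[OF assms(1)[OF vcomp_in] vcomp_in[OF assms(1) assms(1)]]
    by (simp add: assms(3) vcomp_app[OF assms(1) assms(1)])
qed (simp_all add: assms(1))

text \<open>Two parallel composites agree exactly when they agree on elements. Every element of the
  universe is an object of \<open>SET\<close>, so all families belong to
  \<open>extensional (Ob SET)\<close>.\<close>

lemma is_nat_trans_SET_iff:
  "is_nat_trans SET SET G H \<alpha> \<longleftrightarrow>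
    is_functor SET SET G \<and> is_functor SET SET H \<and>
    (\<forall>X. \<alpha> X \<in> elts (fob H X \<up> fob G X)) \<and>
    (\<forall>X Y. \<forall>f\<in>elts (Y \<up> X). \<forall>t\<in>elts (fob G X). \<alpha> Y \<cdot> (far G X Y f \<cdot> t) = far H X Y f \<cdot> (\<alpha> X \<cdot> t))"
proof -
  have "\<alpha> Y \<odot> far G X Y f = far H X Y f \<odot> \<alpha> X \<longleftrightarrow>
      (\<forall>t\<in>elts (fob G X). \<alpha> Y \<cdot> (far G X Y f \<cdot> t) = far H X Y f \<cdot> (\<alpha> X \<cdot> t))"
    if G: "is_functor SET SET G" and H: "is_functor SET SET H"
      and \<alpha>: "\<And>X. \<alpha> X \<in> elts (fob H X \<up> fob G X)" and f: "f \<in> elts (Y \<up> X)" for X Y f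
  proof -
    have "(\<alpha> Y \<odot> far G X Y f) \<cdot> t = \<alpha> Y \<cdot> (far G X Y f \<cdot> t)"
      "(far H X Y f \<odot> \<alpha> X) \<cdot> t = far H X Y f \<cdot> (\<alpha> X \<cdot> t)" if "t \<in> elts (fob G X)" for t
      using that by (auto intro: vcomp_app SET_arr[OF G f] SET_arr[OF H f] \<alpha>)
    then show ?thesis
      using vexp_eqI[OF vcomp_in[OF SET_arr[OF G f] \<alpha>] vcomp_in[OF \<alpha> SET_arr[OF H f]]] by metis
  qed
  then show ?thesis
    unfolding is_nat_trans_def by (auto simp: extensional_def)
qed

lemma is_nat_trans_SETI:
  assumes "is_functor SET SET G" and "is_functor SET SET H"
    and "\<And>X. \<alpha> X \<in> elts (fob H X \<up> fob G X)"
    and "\<And>X Y f t. f \<in> elts (Y \<up> X) \<Longrightarrow> t \<in> elts (fob G X) \<Longrightarrow>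
      \<alpha> Y \<cdot> (far G X Y f \<cdot> t) = far H X Y f \<cdot> (\<alpha> X \<cdot> t)"
  shows "is_nat_trans SET SET G H \<alpha>"
  using assms by (simp add: is_nat_trans_SET_iff)

lemma SET_component: "is_nat_trans SET SET G H \<alpha> \<Longrightarrow> \<alpha> X \<in> elts (fob H X \<up> fob G X)"
  and SET_naturality: "is_nat_trans SET SET G H \<alpha> \<Longrightarrow> f \<in> elts (Y \<up> X) \<Longrightarrow> t \<in> elts (fob G X) \<Longrightarrow>
    \<alpha> Y \<cdot> (far G X Y f \<cdot> t) = far H X Y f \<cdot> (\<alpha> X \<cdot> t)"
  unfolding is_nat_trans_SET_iff by blast+

lemma SET_nat_trans_eqI:
  assumes "is_nat_trans SET SET G H \<alpha>" and "is_nat_trans SET SET G H \<beta>"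
    and "\<And>X t. t \<in> elts (fob G X) \<Longrightarrow> \<alpha> X \<cdot> t = \<beta> X \<cdot> t"
  shows "\<alpha> = \<beta>"
  using vexp_eqI[OF SET_component[OF assms(1)] SET_component[OF assms(2)]] assms(3) by (intro ext) simp

lemma SET_whisker_simps [simp]:
  "vert_comp SET SET \<beta> \<alpha> X = \<beta> X \<odot> \<alpha> X"
  "pre_whisker SET \<alpha> F X = \<alpha> (fob F X)"
  "post_whisker SET F G H \<alpha> X = far F (fob G X) (fob H X) (\<alpha> X)"
  by (simp_all add: vert_comp_def pre_whisker_def post_whisker_def)

section \<open>The familiar of \<open>A \<times> (-)\<close>\<close>

lemma prod_functor_simps [simp]:
  "fob (prod_functor A) X = A \<otimes> X"
  "f \<in> elts (Y \<up> X) \<Longrightarrow> far (prod_functor A) X Y f = id_times A X f"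
  by (simp_all add: prod_functor_def)

lemma id_times_id: "p \<in> elts (A \<otimes> X) \<Longrightarrow> id_times A X (vlam X (\<lambda>x. x)) \<cdot> p = p"
  by (simp add: id_times_app vsnd_in vpair_vfst_vsnd)

lemma id_times_vcomp:
  assumes "f \<in> elts (Y \<up> X)" and "g \<in> elts (Z \<up> Y)" and "p \<in> elts (A \<otimes> X)"
  shows "id_times A X (g \<odot> f) \<cdot> p = id_times A Y g \<cdot> (id_times A X f \<cdot> p)"
  using assms by (simp add: id_times_app vcomp_app[OF assms(1,2)] vfst_in vsnd_in app_in)

lemma is_functor_prod_functor: "is_functor SET SET (prod_functor A)"
  unfolding prod_functor_def
  by (rule is_functor_SET_mkI) (auto intro: id_times_in id_times_id id_times_vcomp)

section \<open>The functor \<open>FF A\<close>, on objects and on arrows\<close>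

lemma FF_obj_ob [simp]: "fob (FF_obj A G) X = (A \<otimes> fob G X) \<up> (A \<up> X)"
  by (simp add: FF_obj_def)

lemma FF_obj_arr_app:
  assumes "h \<in> elts (Y \<up> X)" and "\<phi> \<in> elts ((A \<otimes> fob G X) \<up> (A \<up> X))" and "\<sigma> \<in> elts (A \<up> Y)"
  shows "far (FF_obj A G) X Y h \<cdot> \<phi> \<cdot> \<sigma> = id_times A (fob G X) (far G X Y h) \<cdot> (\<phi> \<cdot> (\<sigma> \<odot> h))"
  using assms by (simp add: FF_obj_def)

text \<open>The variable occurs in the exponent of an exponent, so the action is covariant: a map
  pulls valuations on its target back to its source and pushes results forward. Composition is
  respected because pulling back along \<open>g\<close> and then \<open>f\<close> is pulling back
  along \<open>g \<odot> f\<close>.\<close>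

lemma is_functor_FF_obj:
  assumes G: "is_functor SET SET G"
  shows "is_functor SET SET (FF_obj A G)"
proof -
  let ?F1 = "\<lambda>X Y h. vlam ((A \<otimes> fob G X) \<up> (A \<up> X)) (\<lambda>\<phi>. vlam (A \<up> Y) (\<lambda>\<sigma>.
       id_times A (fob G X) (far G X Y h) \<cdot> (\<phi> \<cdot> (\<sigma> \<odot> h))))"
  have F1: "?F1 X Y h \<in> elts (((A \<otimes> fob G Y) \<up> (A \<up> Y)) \<up> ((A \<otimes> fob G X) \<up> (A \<up> X)))"
    if "h \<in> elts (Y \<up> X)" for X Y h
    using that by (intro vlam_in_vexp app_in[OF id_times_in[OF SET_arr[OF G]]])
      (auto intro: app_in vcomp_in)
  show ?thesis
    unfolding FF_obj_def
  proof (rule is_functor_SET_mkI[OF F1])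
    fix X \<phi> assume \<phi>: "\<phi> \<in> elts ((A \<otimes> fob G X) \<up> (A \<up> X))"
    have id: "vlam X (\<lambda>x. x) \<in> elts (X \<up> X)"
      by (rule vlam_in_vexp)
    have "\<sigma> \<odot> vlam X (\<lambda>x. x) = \<sigma>" if "\<sigma> \<in> elts (A \<up> X)" for \<sigma>
      using category_Id_right[OF is_category_SET, of X A \<sigma>] that by simp
    then show "?F1 X X (vlam X (\<lambda>x. x)) \<cdot> \<phi> = \<phi>"
      using \<phi> by (intro vexp_eqI[OF app_in[OF F1[OF id]] \<phi>])
        (simp_all add: id_times_app app_in[OF \<phi>] vsnd_in[OF app_in[OF \<phi>]] SET_arr_Id[OF G]
          vpair_vfst_vsnd[OF app_in[OF \<phi>]])
  next
    fix X Y Z f g \<phi>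
    assume f: "f \<in> elts (Y \<up> X)" and g: "g \<in> elts (Z \<up> Y)" and \<phi>: "\<phi> \<in> elts ((A \<otimes> fob G X) \<up> (A \<up> X))"
    show "?F1 X Z (g \<odot> f) \<cdot> \<phi> = ?F1 Y Z g \<cdot> (?F1 X Y f \<cdot> \<phi>)"
    proof (rule vexp_eqI[OF app_in[OF F1[OF vcomp_in[OF f g]] \<phi>] app_in[OF F1[OF g] app_in[OF F1[OF f] \<phi>]]])
      fix \<sigma> assume \<sigma>: "\<sigma> \<in> elts (A \<up> Z)"
      have "\<sigma> \<odot> (g \<odot> f) = (\<sigma> \<odot> g) \<odot> f"
        using category_assoc[OF is_category_SET, of X Y Z A f g \<sigma>] f g \<sigma> by simp
      moreover have "\<phi> \<cdot> ((\<sigma> \<odot> g) \<odot> f) \<in> elts (A \<otimes> fob G X)"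
        by (rule app_in[OF \<phi> vcomp_in[OF f vcomp_in[OF g \<sigma>]]])
      ultimately show "?F1 X Z (g \<odot> f) \<cdot> \<phi> \<cdot> \<sigma> = ?F1 Y Z g \<cdot> (?F1 X Y f \<cdot> \<phi>) \<cdot> \<sigma>"
        using app_in[OF F1[OF f] \<phi>] \<phi> \<sigma> vcomp_in[OF g \<sigma>]
        by (simp add: id_times_app vfst_in vsnd_in app_in[OF SET_arr[OF G f]]
            SET_arr_Comp[OF G f g])
    qed
  qed
qed

lemma FF_ob [simp]: "is_functor SET SET G \<Longrightarrow> fob (FF A) G = FF_obj A G"
  by (simp add: FF_def)

lemma FF_arr:
  assumes "is_nat_trans SET SET G H \<alpha>"
  shows "far (FF A) G H \<alpha> X = exp_map (A \<up> X) (A \<otimes> fob G X) (id_times A (fob G X) (\<alpha> X))"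
  using assms nat_trans_source[OF assms] nat_trans_target[OF assms] by (simp add: FF_def)

lemma FF_arr_app:
  assumes \<alpha>: "is_nat_trans SET SET G H \<alpha>"
    and "\<phi> \<in> elts ((A \<otimes> fob G X) \<up> (A \<up> X))" and "\<sigma> \<in> elts (A \<up> X)"
  shows "far (FF A) G H \<alpha> X \<cdot> \<phi> \<cdot> \<sigma> = id_times A (fob G X) (\<alpha> X) \<cdot> (\<phi> \<cdot> \<sigma>)"
  using assms by (simp add: FF_arr exp_map_app[OF id_times_in[OF SET_component[OF \<alpha>]]])

text \<open>The arrow part acts on the result of \<phi>, while pulling back a valuation acts on its
  argument, so the two do not interfere. What remains is naturality of \<alpha> at the second
  component of the result.\<close>

lemma is_nat_trans_FF_arr:
  assumes \<alpha>: "is_nat_trans SET SET G H \<alpha>"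
  shows "is_nat_trans SET SET (FF_obj A G) (FF_obj A H) (far (FF A) G H \<alpha>)"
proof -
  note G = nat_trans_source[OF \<alpha>] and H = nat_trans_target[OF \<alpha>]
  note FG = is_functor_FF_obj[OF G, of A] and FH = is_functor_FF_obj[OF H, of A]
  have comp: "far (FF A) G H \<alpha> X \<in> elts (fob (FF_obj A H) X \<up> fob (FF_obj A G) X)" for X
    using exp_map_in[OF id_times_in[OF SET_component[OF \<alpha>]]] by (simp add: FF_arr[OF \<alpha>])
  show ?thesis
  proof (rule is_nat_trans_SETI[OF FG FH comp])
    fix X Y h \<phi>
    assume h: "h \<in> elts (Y \<up> X)" and \<phi>: "\<phi> \<in> elts (fob (FF_obj A G) X)"
    show "far (FF A) G H \<alpha> Y \<cdot> (far (FF_obj A G) X Y h \<cdot> \<phi>) =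
        far (FF_obj A H) X Y h \<cdot> (far (FF A) G H \<alpha> X \<cdot> \<phi>)"
    proof (rule vexp_eqI)
      show "far (FF A) G H \<alpha> Y \<cdot> (far (FF_obj A G) X Y h \<cdot> \<phi>) \<in> elts ((A \<otimes> fob H Y) \<up> (A \<up> Y))"
        using app_in[OF comp app_in[OF SET_arr[OF FG h] \<phi>]] by simp
      show "far (FF_obj A H) X Y h \<cdot> (far (FF A) G H \<alpha> X \<cdot> \<phi>) \<in> elts ((A \<otimes> fob H Y) \<up> (A \<up> Y))"
        using app_in[OF SET_arr[OF FH h] app_in[OF comp \<phi>]] by simp
      fix \<sigma> assume \<sigma>: "\<sigma> \<in> elts (A \<up> Y)"
      have p: "\<phi> \<cdot> (\<sigma> \<odot> h) \<in> elts (A \<otimes> fob G X)"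
        using app_in[of \<phi> "A \<otimes> fob G X" "A \<up> X"] \<phi> vcomp_in[OF h \<sigma>] by simp
      have "far (FF A) G H \<alpha> Y \<cdot> (far (FF_obj A G) X Y h \<cdot> \<phi>) \<cdot> \<sigma> =
          id_times A (fob G Y) (\<alpha> Y) \<cdot> (id_times A (fob G X) (far G X Y h) \<cdot> (\<phi> \<cdot> (\<sigma> \<odot> h)))"
        using FF_arr_app[OF \<alpha>, of "far (FF_obj A G) X Y h \<cdot> \<phi>" A Y \<sigma>] app_in[OF SET_arr[OF FG h] \<phi>] \<phi> \<sigma>
        by (simp add: FF_obj_arr_app[OF h])
      also have "\<dots> = id_times A (fob H X) (far H X Y h) \<cdot> (id_times A (fob G X) (\<alpha> X) \<cdot> (\<phi> \<cdot> (\<sigma> \<odot> h)))"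
        using p by (simp add: id_times_app vfst_in vsnd_in app_in[OF SET_arr[OF G h]]
            app_in[OF SET_component[OF \<alpha>]] SET_naturality[OF \<alpha> h])
      also have "\<dots> = far (FF_obj A H) X Y h \<cdot> (far (FF A) G H \<alpha> X \<cdot> \<phi>) \<cdot> \<sigma>"
        using FF_obj_arr_app[OF h, of "far (FF A) G H \<alpha> X \<cdot> \<phi>" A H \<sigma>] app_in[OF comp \<phi>]
          FF_arr_app[OF \<alpha>, of \<phi> A X "\<sigma> \<odot> h"] \<phi> \<sigma> vcomp_in[OF h \<sigma>] by simp
      finally show "far (FF A) G H \<alpha> Y \<cdot> (far (FF_obj A G) X Y h \<cdot> \<phi>) \<cdot> \<sigma> =
          far (FF_obj A H) X Y h \<cdot> (far (FF A) G H \<alpha> X \<cdot> \<phi>) \<cdot> \<sigma>" .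
    qed
  qed
qed

text \<open>Values of such transformations are again functions, so extensionality is applied twice:
  at an element and then at a valuation.\<close>

lemma FF_obj_nat_trans_eqI:
  assumes \<alpha>: "is_nat_trans SET SET H (FF_obj A G) \<alpha>" and \<beta>: "is_nat_trans SET SET H (FF_obj A G) \<beta>"
    and eq: "\<And>X t \<sigma>. t \<in> elts (fob H X) \<Longrightarrow> \<sigma> \<in> elts (A \<up> X) \<Longrightarrow> \<alpha> X \<cdot> t \<cdot> \<sigma> = \<beta> X \<cdot> t \<cdot> \<sigma>"
  shows "\<alpha> = \<beta>"
proof (rule SET_nat_trans_eqI[OF \<alpha> \<beta>])
  fix X t assume t: "t \<in> elts (fob H X)"
  show "\<alpha> X \<cdot> t = \<beta> X \<cdot> t"
    using app_in[OF SET_component[OF \<alpha>] t] app_in[OF SET_component[OF \<beta>] t]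
    by (simp add: vexp_eqI[of _ _ "A \<up> X", OF _ _ eq[OF t]])
qed

lemma is_functor_FF: "is_functor (functor_cat SET SET) (functor_cat SET SET) (FF A)"
proof -
  let ?F1 = "\<lambda>G H \<alpha>. far (FF A) G H \<alpha>"
  \<comment> \<open>Rebuilding \<open>FF A\<close> from its own arrow part lets the functor laws be
    checked with the facts about \<open>far (FF A)\<close> rather than with the raw formula.\<close>
  have FF_eq: "FF A = mk_functor (functor_cat SET SET) (FF_obj A) ?F1"
    unfolding FF_def by (rule mk_functor_cong) simp_all
  have id: "?F1 G G (\<lambda>X\<in>Ob SET. Id SET (fob G X)) = (\<lambda>X\<in>Ob SET. Id SET (fob (FF_obj A G) X))"
    if G: "is_functor SET SET G" for G
  proof -
    note idG = is_nat_trans_Id[OF G]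
    show ?thesis
    proof (rule FF_obj_nat_trans_eqI[OF is_nat_trans_FF_arr[OF idG] is_nat_trans_Id[OF is_functor_FF_obj[OF G]]])
      fix X \<phi> \<sigma> assume "\<phi> \<in> elts (fob (FF_obj A G) X)" and \<sigma>: "\<sigma> \<in> elts (A \<up> X)"
      then have \<phi>: "\<phi> \<in> elts ((A \<otimes> fob G X) \<up> (A \<up> X))"
        by simp
      show "?F1 G G (\<lambda>X\<in>Ob SET. Id SET (fob G X)) X \<cdot> \<phi> \<cdot> \<sigma> =
          (\<lambda>X\<in>Ob SET. Id SET (fob (FF_obj A G) X)) X \<cdot> \<phi> \<cdot> \<sigma>"
        unfolding FF_arr_app[OF idG \<phi> \<sigma>] using \<phi> \<sigma> by (simp add: id_times_id app_in[OF \<phi>])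
    qed
  qed
  have comp: "?F1 G K (vert_comp SET SET \<beta> \<alpha>) = vert_comp SET SET (?F1 H K \<beta>) (?F1 G H \<alpha>)"
    if \<alpha>: "is_nat_trans SET SET G H \<alpha>" and \<beta>: "is_nat_trans SET SET H K \<beta>" for G H K \<alpha> \<beta>
  proof (rule FF_obj_nat_trans_eqI)
    note \<beta>\<alpha> = is_nat_trans_vert_comp[OF \<alpha> \<beta>]
    note F\<alpha> = is_nat_trans_FF_arr[OF \<alpha>] and F\<beta> = is_nat_trans_FF_arr[OF \<beta>]
    show "is_nat_trans SET SET (FF_obj A G) (FF_obj A K) (?F1 G K (vert_comp SET SET \<beta> \<alpha>))"
      by (rule is_nat_trans_FF_arr[OF \<beta>\<alpha>])
    show "is_nat_trans SET SET (FF_obj A G) (FF_obj A K) (vert_comp SET SET (?F1 H K \<beta>) (?F1 G H \<alpha>))"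
      by (rule is_nat_trans_vert_comp[OF F\<alpha> F\<beta>])
    fix X \<phi> \<sigma> assume \<phi>': "\<phi> \<in> elts (fob (FF_obj A G) X)" and \<sigma>: "\<sigma> \<in> elts (A \<up> X)"
    then have \<phi>: "\<phi> \<in> elts ((A \<otimes> fob G X) \<up> (A \<up> X))"
      by simp
    have F\<alpha>\<phi>: "?F1 G H \<alpha> X \<cdot> \<phi> \<in> elts ((A \<otimes> fob H X) \<up> (A \<up> X))"
      using app_in[OF SET_component[OF F\<alpha>] \<phi>'] by simp
    show "?F1 G K (vert_comp SET SET \<beta> \<alpha>) X \<cdot> \<phi> \<cdot> \<sigma> =
        vert_comp SET SET (?F1 H K \<beta>) (?F1 G H \<alpha>) X \<cdot> \<phi> \<cdot> \<sigma>"
      using vcomp_app[OF SET_component[OF F\<alpha>] SET_component[OF F\<beta>] \<phi>']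
        id_times_vcomp[OF SET_component[OF \<alpha>] SET_component[OF \<beta>] app_in[OF \<phi> \<sigma>]]
      by (simp add: FF_arr_app[OF \<beta>\<alpha> \<phi> \<sigma>] FF_arr_app[OF \<alpha> \<phi> \<sigma>] FF_arr_app[OF \<beta> F\<alpha>\<phi> \<sigma>])
  qed
  show ?thesis
    by (subst FF_eq, rule is_functor_mk_functorI[OF is_category_functor_cat is_category_functor_cat])
      (simp_all add: is_functor_FF_obj is_nat_trans_FF_arr id[simplified] comp)
qed

section \<open>The projections and the counit\<close>

lemma fst_map_in: "vlam (A \<otimes> X) vfst \<in> elts (A \<up> (A \<otimes> X))"
  and snd_map_in: "vlam (A \<otimes> X) vsnd \<in> elts (X \<up> (A \<otimes> X))"
  by (auto intro: vlam_in_vexp vfst_in vsnd_in)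

lemma eps_app:
  assumes "\<phi> \<in> elts ((A \<otimes> fob G (A \<otimes> X)) \<up> (A \<up> (A \<otimes> X)))"
  shows "eps A G X \<cdot> \<phi> =
    id_times A (fob G (A \<otimes> X)) (far G (A \<otimes> X) X (vlam (A \<otimes> X) vsnd)) \<cdot> (\<phi> \<cdot> vlam (A \<otimes> X) vfst)"
  using assms by (simp add: eps_def)

lemma eps_in:
  assumes G: "is_functor SET SET G"
  shows "eps A G X \<in> elts ((A \<otimes> fob G X) \<up> ((A \<otimes> fob G (A \<otimes> X)) \<up> (A \<up> (A \<otimes> X))))"
  unfolding eps_def Let_def
  by (rule vlam_in_vexp) (rule app_in[OF id_times_in[OF SET_arr[OF G snd_map_in]] app_in[OF _ fst_map_in]])

text \<open>Naturality of the counit is naturality of the two projections: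
  \<open>id_times A X f\<close> preserves the first, so the valuation used for evaluation is pulled
  back to its counterpart on the source, and it carries the second across \<open>f\<close>.\<close>

lemma is_nat_trans_eps:
  assumes G: "is_functor SET SET G"
  shows "is_nat_trans SET SET (comp_functor SET (FF_obj A G) (prod_functor A))
    (comp_functor SET (prod_functor A) G) (eps A G)"
proof (rule is_nat_trans_SETI)
  note FG = is_functor_FF_obj[OF G, of A]
  show "is_functor SET SET (comp_functor SET (FF_obj A G) (prod_functor A))"
    by (rule is_functor_comp_functor[OF is_functor_prod_functor FG])
  show "is_functor SET SET (comp_functor SET (prod_functor A) G)"
    by (rule is_functor_comp_functor[OF G is_functor_prod_functor])
  show "eps A G X \<in> elts (fob (comp_functor SET (prod_functor A) G) X \<up>
      fob (comp_functor SET (FF_obj A G) (prod_functor A)) X)" for X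
    using eps_in[OF G] by simp
  fix X Y f \<phi>
  assume f: "f \<in> elts (Y \<up> X)" and "\<phi> \<in> elts (fob (comp_functor SET (FF_obj A G) (prod_functor A)) X)"
  then have \<phi>: "\<phi> \<in> elts ((A \<otimes> fob G (A \<otimes> X)) \<up> (A \<up> (A \<otimes> X)))"
    by simp
  note Af = id_times_in[OF f, of A]
  have fst_Af: "vlam (A \<otimes> Y) vfst \<odot> id_times A X f = vlam (A \<otimes> X) vfst"
    and snd_Af: "vlam (A \<otimes> Y) vsnd \<odot> id_times A X f = f \<odot> vlam (A \<otimes> X) vsnd"
    by (simp_all add: vcomp_eq_vlam[OF Af fst_map_in] vcomp_eq_vlam[OF Af snd_map_in]
        vcomp_eq_vlam[OF snd_map_in f] id_times_app vfst_in vsnd_in app_in[OF f] cong: vlam_cong)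
  let ?p = "\<phi> \<cdot> vlam (A \<otimes> X) vfst"
  have p: "?p \<in> elts (A \<otimes> fob G (A \<otimes> X))"
    by (rule app_in[OF \<phi> fst_map_in])
  have "far (FF_obj A G) (A \<otimes> X) (A \<otimes> Y) (id_times A X f) \<cdot> \<phi>
      \<in> elts ((A \<otimes> fob G (A \<otimes> Y)) \<up> (A \<up> (A \<otimes> Y)))"
    using app_in[OF SET_arr[OF FG Af]] \<phi> by simp
  then have "eps A G Y \<cdot> (far (FF_obj A G) (A \<otimes> X) (A \<otimes> Y) (id_times A X f) \<cdot> \<phi>) =
      id_times A (fob G (A \<otimes> Y)) (far G (A \<otimes> Y) Y (vlam (A \<otimes> Y) vsnd)) \<cdot>
        (id_times A (fob G (A \<otimes> X)) (far G (A \<otimes> X) (A \<otimes> Y) (id_times A X f)) \<cdot> ?p)"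
    by (simp add: eps_app FF_obj_arr_app[OF Af \<phi> fst_map_in] fst_Af)
  also have "\<dots> = id_times A (fob G X) (far G X Y f) \<cdot> (eps A G X \<cdot> \<phi>)"
    using p by (simp add: eps_app[OF \<phi>] id_times_app vfst_in vsnd_in app_in[OF SET_arr[OF G Af]]
        app_in[OF SET_arr[OF G snd_map_in]] SET_arr_Comp[OF G Af snd_map_in]
        SET_arr_Comp[OF G snd_map_in f] snd_Af)
  finally show "eps A G Y \<cdot> (far (comp_functor SET (FF_obj A G) (prod_functor A)) X Y f \<cdot> \<phi>) =
      far (comp_functor SET (prod_functor A) G) X Y f \<cdot> (eps A G X \<cdot> \<phi>)"
    using f SET_arr[OF G f] by simp
qed

section \<open>Sections of the second projection and the transpose\<close>

definition pair_map :: "'u::set_universe \<Rightarrow> 'u \<Rightarrow> 'u" where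
  "pair_map X \<sigma> = vlam X (\<lambda>x. vpair (\<sigma> \<cdot> x) x)"

lemma pair_map_in: "\<sigma> \<in> elts (A \<up> X) \<Longrightarrow> pair_map X \<sigma> \<in> elts ((A \<otimes> X) \<up> X)"
  unfolding pair_map_def by (rule vlam_in_vexp) (simp add: app_in)

text \<open>Rewrites a section over the target of \<open>h\<close> into one over its source followed
  by \<open>id_times A X h\<close>, an arrow in the image of the product functor, where naturality
  of \<theta> applies.\<close>

lemma pair_map_vcomp:
  assumes "h \<in> elts (Y \<up> X)" and "\<sigma> \<in> elts (A \<up> Y)"
  shows "pair_map Y \<sigma> \<odot> h = id_times A X h \<odot> pair_map X (\<sigma> \<odot> h)"
proof -
  note \<sigma>h = vcomp_in[OF assms]
  show ?thesis
    unfolding vcomp_eq_vlam[OF assms(1) pair_map_in[OF assms(2)]]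
      vcomp_eq_vlam[OF pair_map_in[OF \<sigma>h] id_times_in[OF assms(1)]]
    by (rule vlam_cong)
      (simp add: pair_map_def id_times_app vcomp_app[OF assms] app_in[OF assms(1)]
        app_in[OF assms(2)])
qed

text \<open>Every valuation is the pullback of the generic one, the first projection, along its own
  section. These identities drive uniqueness.\<close>

lemma assumes \<sigma>: "\<sigma> \<in> elts (A \<up> X)"
  shows fst_pair_map: "vlam (A \<otimes> X) vfst \<odot> pair_map X \<sigma> = \<sigma>"
    and snd_pair_map: "vlam (A \<otimes> X) vsnd \<odot> pair_map X \<sigma> = vlam X (\<lambda>x. x)"
  unfolding vcomp_eq_vlam[OF pair_map_in[OF \<sigma>] fst_map_in] vcomp_eq_vlam[OF pair_map_in[OF \<sigma>] snd_map_in]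
  by (simp_all add: pair_map_def app_in[OF \<sigma>] vlam_app[OF \<sigma>] cong: vlam_cong)

text \<open>The section of the generic valuation copies the A-component, p to (pi1 p, p); projecting
  inside the second factor discards the copy. This identity drives existence.\<close>

lemma id_times_snd_pair_map_fst:
  "id_times A (A \<otimes> X) (vlam (A \<otimes> X) vsnd) \<odot> pair_map (A \<otimes> X) (vlam (A \<otimes> X) vfst) =
    vlam (A \<otimes> X) (\<lambda>p. p)"
  unfolding vcomp_eq_vlam[OF pair_map_in[OF fst_map_in] id_times_in[OF snd_map_in]]
  by (rule vlam_cong) (simp add: pair_map_def id_times_app vfst_in vpair_vfst_vsnd)

text \<open>The transpose is determined by its values on single valuations: \<open>\<epsilon>\<^sup>\<sigma> \<circ> c\<^sub>X = \<langle>\<sigma>, id\<rangle>\<close>.\<close>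

lemma
  assumes H: "is_functor SET SET H" and \<theta>: "\<theta> X \<in> elts (Z \<up> fob H (A \<otimes> X))"
  shows hat_in: "hat A H \<theta> X \<in> elts ((Z \<up> (A \<up> X)) \<up> fob H X)"
    and hat_app: "t \<in> elts (fob H X) \<Longrightarrow> \<sigma> \<in> elts (A \<up> X) \<Longrightarrow>
      hat A H \<theta> X \<cdot> t \<cdot> \<sigma> = \<theta> X \<cdot> (far H X (A \<otimes> X) (pair_map X \<sigma>) \<cdot> t)"
proof -
  let ?S = "A \<up> X" and ?P = "A \<otimes> X"
  have c: "cmap A X \<in> elts ((?P \<up> ?S) \<up> X)"
    unfolding cmap_def by (intro vlam_in_vexp) (simp add: app_in)
  have ev: "vlam (?P \<up> ?S) (\<lambda>g. g \<cdot> \<sigma>) \<in> elts (?P \<up> (?P \<up> ?S))" if "\<sigma> \<in> elts ?S" for \<sigma>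
    by (rule vlam_in_vexp) (rule app_in[OF _ that])
  have cs: "costrength H ?S ?P \<in> elts ((fob H ?P \<up> ?S) \<up> fob H (?P \<up> ?S))"
    unfolding costrength_def by (intro vlam_in_vexp) (rule app_in[OF SET_arr[OF H ev]])
  note Hc = SET_arr[OF H c] and ex = exp_map_in[OF \<theta>, of ?S]
  show "hat A H \<theta> X \<in> elts ((Z \<up> ?S) \<up> fob H X)"
    unfolding hat_def by (rule vcomp_in[OF vcomp_in[OF Hc cs] ex])
  assume t: "t \<in> elts (fob H X)" and \<sigma>: "\<sigma> \<in> elts ?S"
  note Hct = app_in[OF Hc t]
  have "vlam (?P \<up> ?S) (\<lambda>g. g \<cdot> \<sigma>) \<odot> cmap A X = pair_map X \<sigma>"
    unfolding vcomp_eq_vlam[OF c ev[OF \<sigma>]] pair_map_def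
    by (rule vlam_cong) (use app_in[OF c] \<sigma> in \<open>simp, simp add: cmap_def\<close>)
  \<comment> \<open>At \<sigma> the costrength acts by \<open>H\<close> of evaluation at \<sigma>,
    which functoriality fuses with the action of \<open>cmap\<close>.\<close>
  moreover have "costrength H ?S ?P \<cdot> (far H X (?P \<up> ?S) (cmap A X) \<cdot> t) \<cdot> \<sigma> =
      far H (?P \<up> ?S) ?P (vlam (?P \<up> ?S) (\<lambda>g. g \<cdot> \<sigma>)) \<cdot> (far H X (?P \<up> ?S) (cmap A X) \<cdot> t)"
    using Hct \<sigma> by (simp add: costrength_def)
  ultimately show "hat A H \<theta> X \<cdot> t \<cdot> \<sigma> = \<theta> X \<cdot> (far H X ?P (pair_map X \<sigma>) \<cdot> t)"
    unfolding hat_def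
    by (simp add: vcomp_app[OF vcomp_in[OF Hc cs] ex t] vcomp_app[OF Hc cs t]
        exp_map_app[OF \<theta> app_in[OF cs Hct] \<sigma>] SET_arr_Comp[OF H c ev[OF \<sigma>] t])
qed

context
  fixes A :: "'u::set_universe" and G H :: "'u endo" and \<theta> :: "'u \<Rightarrow> 'u"
  assumes G: "is_functor SET SET G" and H: "is_functor SET SET H"
    and \<theta>: "is_nat_trans SET SET (comp_functor SET H (prod_functor A)) (comp_functor SET (prod_functor A) G) \<theta>"
begin

lemma \<theta>_in: "\<theta> X \<in> elts ((A \<otimes> fob G X) \<up> fob H (A \<otimes> X))"
  using SET_component[OF \<theta>, of X] by simp

lemma \<theta>_naturality:
  assumes "f \<in> elts (Y \<up> X)" and "t \<in> elts (fob H (A \<otimes> X))"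
  shows "\<theta> Y \<cdot> (far H (A \<otimes> X) (A \<otimes> Y) (id_times A X f) \<cdot> t) =
    id_times A (fob G X) (far G X Y f) \<cdot> (\<theta> X \<cdot> t)"
  using SET_naturality[OF \<theta> assms(1)] assms SET_arr[OF G assms(1)] by simp

lemmas hat_\<theta>_in = hat_in[where \<theta> = \<theta>, OF H \<theta>_in]
  and hat_\<theta>_app = hat_app[where \<theta> = \<theta>, OF H \<theta>_in]

text \<open>Both sides are values of \<theta> at images of \<open>t\<close> under sections.
  \<open>pair_map_vcomp\<close> moves the section from \<open>Y\<close> to \<open>X\<close>, and
  naturality of \<theta> along \<open>h\<close> then carries \<open>h\<close> from the argument of
  \<theta> to its result.\<close>

lemma is_nat_trans_hat: "is_nat_trans SET SET H (FF_obj A G) (hat A H \<theta>)"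
proof (rule is_nat_trans_SETI[OF H is_functor_FF_obj[OF G]])
  show "hat A H \<theta> X \<in> elts (fob (FF_obj A G) X \<up> fob H X)" for X
    using hat_\<theta>_in by simp
  fix X Y h t assume h: "h \<in> elts (Y \<up> X)" and t: "t \<in> elts (fob H X)"
  note Hht = app_in[OF SET_arr[OF H h] t]
  show "hat A H \<theta> Y \<cdot> (far H X Y h \<cdot> t) = far (FF_obj A G) X Y h \<cdot> (hat A H \<theta> X \<cdot> t)"
  proof (rule vexp_eqI[OF app_in[OF hat_\<theta>_in Hht]])
    show "far (FF_obj A G) X Y h \<cdot> (hat A H \<theta> X \<cdot> t) \<in> elts ((A \<otimes> fob G Y) \<up> (A \<up> Y))"
      using app_in[OF SET_arr[OF is_functor_FF_obj[OF G] h]] app_in[OF hat_\<theta>_in t] by simp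
    fix \<sigma> assume \<sigma>: "\<sigma> \<in> elts (A \<up> Y)"
    note \<sigma>h = vcomp_in[OF h \<sigma>]
    have "hat A H \<theta> Y \<cdot> (far H X Y h \<cdot> t) \<cdot> \<sigma> = \<theta> Y \<cdot> (far H X (A \<otimes> Y) (pair_map Y \<sigma> \<odot> h) \<cdot> t)"
      by (simp add: hat_\<theta>_app[OF Hht \<sigma>] SET_arr_Comp[OF H h pair_map_in[OF \<sigma>] t])
    also have "\<dots> = \<theta> Y \<cdot> (far H (A \<otimes> X) (A \<otimes> Y) (id_times A X h) \<cdot>
        (far H X (A \<otimes> X) (pair_map X (\<sigma> \<odot> h)) \<cdot> t))"
      by (simp add: pair_map_vcomp[OF h \<sigma>] SET_arr_Comp[OF H pair_map_in[OF \<sigma>h] id_times_in[OF h] t])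
    also have "\<dots> = id_times A (fob G X) (far G X Y h) \<cdot> (hat A H \<theta> X \<cdot> t \<cdot> (\<sigma> \<odot> h))"
      by (simp add: \<theta>_naturality[OF h app_in[OF SET_arr[OF H pair_map_in[OF \<sigma>h]] t]] hat_\<theta>_app[OF t \<sigma>h])
    also have "\<dots> = far (FF_obj A G) X Y h \<cdot> (hat A H \<theta> X \<cdot> t) \<cdot> \<sigma>"
      by (rule FF_obj_arr_app[OF h app_in[OF hat_\<theta>_in t] \<sigma>, symmetric])
    finally show "hat A H \<theta> Y \<cdot> (far H X Y h \<cdot> t) \<cdot> \<sigma> = far (FF_obj A G) X Y h \<cdot> (hat A H \<theta> X \<cdot> t) \<cdot> \<sigma>" .
  qed
qed

text \<open>The counit evaluates the transpose at the generic valuation and then applies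
  \<open>G\<close> to the second projection. Naturality of \<theta> along that projection pulls it
  inside, next to the section of the generic valuation, where the two compose to the
  identity.\<close>

lemma eps_hat: "vert_comp SET SET (eps A G) (pre_whisker SET (hat A H \<theta>) (prod_functor A)) = \<theta>"
proof
  fix X
  show "vert_comp SET SET (eps A G) (pre_whisker SET (hat A H \<theta>) (prod_functor A)) X = \<theta> X"
  proof (rule vexp_eqI[OF _ \<theta>_in])
    show "vert_comp SET SET (eps A G) (pre_whisker SET (hat A H \<theta>) (prod_functor A)) X
        \<in> elts ((A \<otimes> fob G X) \<up> fob H (A \<otimes> X))"
      using vcomp_in[OF hat_\<theta>_in eps_in[OF G]] by simp
    fix t assume t: "t \<in> elts (fob H (A \<otimes> X))"
    note pm = pair_map_in[OF fst_map_in[of A X]]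
    have "eps A G X \<cdot> (hat A H \<theta> (A \<otimes> X) \<cdot> t) =
        id_times A (fob G (A \<otimes> X)) (far G (A \<otimes> X) X (vlam (A \<otimes> X) vsnd)) \<cdot>
        (\<theta> (A \<otimes> X) \<cdot> (far H (A \<otimes> X) (A \<otimes> (A \<otimes> X)) (pair_map (A \<otimes> X) (vlam (A \<otimes> X) vfst)) \<cdot> t))"
      by (simp add: eps_app[OF app_in[OF hat_\<theta>_in t]] hat_\<theta>_app[OF t fst_map_in])
    also have "\<dots> = \<theta> X \<cdot> t"
      using t by (simp add: \<theta>_naturality[OF snd_map_in app_in[OF SET_arr[OF H pm] t], symmetric]
          SET_arr_Comp[OF H pm id_times_in[OF snd_map_in] t] id_times_snd_pair_map_fst SET_arr_Id[OF H])
    finally show "vert_comp SET SET (eps A G) (pre_whisker SET (hat A H \<theta>) (prod_functor A)) X \<cdot> t = \<theta> X \<cdot> t"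
      by (simp add: vcomp_app[OF hat_\<theta>_in eps_in[OF G] t])
  qed
qed

text \<open>Naturality of \<open>\<tau>\<close> along \<open>\<langle>\<sigma>, id\<rangle>\<close> moves the valuation \<open>\<sigma>\<close> to \<open>\<pi>\<^sub>1\<close>, where \<open>\<epsilon>\<close> evaluates.\<close>

lemma hat_unique:
  assumes \<tau>: "is_nat_trans SET SET H (FF_obj A G) \<tau>"
    and eq: "vert_comp SET SET (eps A G) (pre_whisker SET \<tau> (prod_functor A)) = \<theta>"
  shows "\<tau> = hat A H \<theta>"
proof (rule FF_obj_nat_trans_eqI[OF \<tau> is_nat_trans_hat])
  fix X t \<sigma> assume t: "t \<in> elts (fob H X)" and \<sigma>: "\<sigma> \<in> elts (A \<up> X)"
  note pm = pair_map_in[OF \<sigma>] and Gpm = SET_arr[OF G pair_map_in[OF \<sigma>]]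
  let ?u = "far H X (A \<otimes> X) (pair_map X \<sigma>) \<cdot> t"
  have \<tau>_in: "\<tau> Y \<in> elts (((A \<otimes> fob G Y) \<up> (A \<up> Y)) \<up> fob H Y)" for Y
    using SET_component[OF \<tau>] by simp
  have u: "?u \<in> elts (fob H (A \<otimes> X))"
    by (rule app_in[OF SET_arr[OF H pm] t])
  have p: "\<tau> X \<cdot> t \<cdot> \<sigma> \<in> elts (A \<otimes> fob G X)"
    by (rule app_in[OF app_in[OF \<tau>_in t] \<sigma>])
  have "hat A H \<theta> X \<cdot> t \<cdot> \<sigma> = \<theta> X \<cdot> ?u"
    by (rule hat_\<theta>_app[OF t \<sigma>])
  also have "\<dots> = eps A G X \<cdot> (\<tau> (A \<otimes> X) \<cdot> ?u)"
    using fun_cong[OF eq, of X] vcomp_app[OF \<tau>_in eps_in[OF G] u] by simp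
  also have "\<dots> = id_times A (fob G (A \<otimes> X)) (far G (A \<otimes> X) X (vlam (A \<otimes> X) vsnd)) \<cdot>
      (far (FF_obj A G) X (A \<otimes> X) (pair_map X \<sigma>) \<cdot> (\<tau> X \<cdot> t) \<cdot> vlam (A \<otimes> X) vfst)"
    unfolding SET_naturality[OF \<tau> pm t, symmetric] by (rule eps_app[OF app_in[OF \<tau>_in u]])
  \<comment> \<open>Evaluation at the first projection becomes evaluation at \<sigma>, by
    \<open>fst_pair_map\<close>.\<close>
  also have "\<dots> = id_times A (fob G (A \<otimes> X)) (far G (A \<otimes> X) X (vlam (A \<otimes> X) vsnd)) \<cdot>
      (id_times A (fob G X) (far G X (A \<otimes> X) (pair_map X \<sigma>)) \<cdot> (\<tau> X \<cdot> t \<cdot> \<sigma>))"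
    by (simp add: FF_obj_arr_app[OF pm app_in[OF \<tau>_in t] fst_map_in] fst_pair_map[OF \<sigma>])
  \<comment> \<open>The section is undone by the second projection under \<open>G\<close>, by
    \<open>snd_pair_map\<close>; the A-component passes through unchanged.\<close>
  also have "\<dots> = \<tau> X \<cdot> t \<cdot> \<sigma>"
    using p by (simp add: id_times_app vfst_in vsnd_in app_in[OF Gpm] SET_arr_Comp[OF G pm snd_map_in]
        snd_pair_map[OF \<sigma>] SET_arr_Id[OF G] vpair_vfst_vsnd)
  finally show "\<tau> X \<cdot> t \<cdot> \<sigma> = hat A H \<theta> X \<cdot> t \<cdot> \<sigma>" ..
qed

end

section \<open>The universal property and the isomorphism of categories\<close>

lemma is_right_Kan_extension_FF_obj:
  assumes G: "is_functor SET SET G"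
  shows "is_right_Kan_extension SET SET SET (prod_functor A) (comp_functor SET (prod_functor A) G)
    (FF_obj A G) (eps A G)"
  unfolding is_right_Kan_extension_def
proof (intro conjI allI impI)
  show "\<exists>!\<tau>. is_nat_trans SET SET H (FF_obj A G) \<tau> \<and>
      vert_comp SET SET (eps A G) (pre_whisker SET \<tau> (prod_functor A)) = \<theta>"
    if "is_functor SET SET H"
      and "is_nat_trans SET SET (comp_functor SET H (prod_functor A)) (comp_functor SET (prod_functor A) G) \<theta>"
    for H \<theta>
    using is_nat_trans_hat[OF G that] eps_hat[OF G that] hat_unique[OF G that] by blast
qed (rule is_functor_prod_functor is_functor_comp_functor[OF G is_functor_prod_functor]
    is_functor_FF_obj[OF G] is_nat_trans_eps[OF G])+

text \<open>The equation identifying the arrow part of \<open>FF A\<close> with the one induced by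
  the universal property. Neither side alters the valuation at which \<phi> is evaluated, so it
  reduces to naturality of \<alpha> at the second projection.\<close>

lemma eps_FF_arr:
  assumes \<alpha>: "is_nat_trans SET SET G H \<alpha>"
  shows "vert_comp SET SET (eps A H) (pre_whisker SET (far (FF A) G H \<alpha>) (prod_functor A)) =
    vert_comp SET SET (post_whisker SET (prod_functor A) G H \<alpha>) (eps A G)"
proof
  fix X
  note G = nat_trans_source[OF \<alpha>] and H = nat_trans_target[OF \<alpha>]
  let ?X = "(A \<otimes> fob G (A \<otimes> X)) \<up> (A \<up> (A \<otimes> X))"
  note \<alpha>X = SET_component[OF \<alpha>, of X]
  have F\<alpha>: "far (FF A) G H \<alpha> (A \<otimes> X) \<in> elts (((A \<otimes> fob H (A \<otimes> X)) \<up> (A \<up> (A \<otimes> X))) \<up> ?X)"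
    using SET_component[OF is_nat_trans_FF_arr[OF \<alpha>]] by simp
  have "eps A H X \<odot> far (FF A) G H \<alpha> (A \<otimes> X) = id_times A (fob G X) (\<alpha> X) \<odot> eps A G X"
  proof (rule vexp_eqI[OF vcomp_in[OF F\<alpha> eps_in[OF H]] vcomp_in[OF eps_in[OF G] id_times_in[OF \<alpha>X]]])
    fix \<phi> assume \<phi>: "\<phi> \<in> elts ?X"
    show "(eps A H X \<odot> far (FF A) G H \<alpha> (A \<otimes> X)) \<cdot> \<phi> = (id_times A (fob G X) (\<alpha> X) \<odot> eps A G X) \<cdot> \<phi>"
      using app_in[OF \<phi> fst_map_in]
      by (simp add: vcomp_app[OF F\<alpha> eps_in[OF H] \<phi>] vcomp_app[OF eps_in[OF G] id_times_in[OF \<alpha>X] \<phi>]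
          eps_app[OF app_in[OF F\<alpha> \<phi>]] eps_app[OF \<phi>] FF_arr_app[OF \<alpha> \<phi> fst_map_in] id_times_app
          vfst_in vsnd_in app_in[OF SET_component[OF \<alpha>]] app_in[OF SET_arr[OF G snd_map_in]]
          SET_naturality[OF \<alpha> snd_map_in])
  qed
  then show "vert_comp SET SET (eps A H) (pre_whisker SET (far (FF A) G H \<alpha>) (prod_functor A)) X =
      vert_comp SET SET (post_whisker SET (prod_functor A) G H \<alpha>) (eps A G) X"
    using \<alpha>X by simp
qed

lemma is_familiar_FF: "is_familiar SET (prod_functor A) (FF A) (eps A)"
  unfolding is_familiar_def
  by (simp add: is_functor_FF is_right_Kan_extension_FF_obj eps_FF_arr)

theorem theorem7:
  fixes A :: "'u::set_universe"
  shows "is_familiar SET (prod_functor A) (FF A) (eps A)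
    \<and> (\<forall>G H \<theta>. is_functor SET SET G \<longrightarrow> is_functor SET SET H \<longrightarrow>
         is_nat_trans SET SET (comp_functor SET H (prod_functor A)) (comp_functor SET (prod_functor A) G) \<theta> \<longrightarrow>
         is_nat_trans SET SET H (fob (FF A) G) (hat A H \<theta>)
         \<and> vert_comp SET SET (eps A G) (pre_whisker SET (hat A H \<theta>) (prod_functor A)) = \<theta>
         \<and> (\<forall>\<tau>. is_nat_trans SET SET H (fob (FF A) G) \<tau>
                \<and> vert_comp SET SET (eps A G) (pre_whisker SET \<tau> (prod_functor A)) = \<theta> \<longrightarrow> \<tau> = hat A H \<theta>))
    \<and> is_iso_functor (DL SET (prod_functor A)) (Coalg (functor_cat SET SET) (FF A)) (DL_to_Coalg A)"
proof (intro conjI allI impI)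
  show "is_familiar SET (prod_functor A) (FF A) (eps A)"
    by (rule is_familiar_FF)
  show "is_iso_functor (DL SET (prod_functor A)) (Coalg (functor_cat SET SET) (FF A)) (DL_to_Coalg A)"
    \<comment> \<open>Unfolded, this is the functor built for an arbitrary familiar, with
      \<open>hat A\<close> as the choice of factorizations.\<close>
    unfolding DL_to_Coalg_def
    by (rule is_iso_functor_DL_Coalg[OF is_familiar_FF is_functor_prod_functor])
      (simp add: is_nat_trans_hat eps_hat)
qed (auto simp: is_nat_trans_hat eps_hat intro: hat_unique)

end
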